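(* Let $T>0$, $\mu>0$, $f\in L^2(0,T)$, and let the discrete spaces $S_h^p(0,T)\subset H^2_{0,\bullet}(0,T)$ satisfy Assumptions A and B (stated in the context). Let $u\in H^2_{0,\bullet}(0,T)$ be the unique solution of $$a_\mu(u,w)=(f,\partial_tw)_{L^2(0,T)}\quad\text{for all }w\in H^2_{0,\bullet}(0,T),$$ and let $u_h\in S_h^p(0,T)$ be the unique solution of $$a_\mu(u_h,\mathcal{L}_Tw_h)=(f,\partial_t\mathcal{L}_Tw_h)_{L^2(0,T)}\quad\text{for all }w_h\in S_h^p(0,T).$$ Then, if $u$ is sufficiently smooth, $$\|\partial_t^\ell u-\partial_t^\ell u_h\|_{L^2(0,T)}\le C_\mu\,h^{p+1-\ell},\qquad\ell=0,1,2,$$ for a positive constant $C_\mu$ depending on $u,p,T,\mu$ but not on $h$.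
   Context: $H^2_{0,\bullet}(0,T):=\{u\in H^2(0,T): u(0)=0\}$, with norm $\|u\|_{H^2_{0,\bullet}(0,T)}:=\|\partial_t^2u\|_{L^2(0,T)}+\frac1T\|\partial_tu\|_{L^2(0,T)}$; $$a_\mu(u,w):=(\partial_t^2u,\partial_t w)_{L^2(0,T)}+\partial_tu(0)\,\partial_tw(0)+\mu\,(u,\partial_tw)_{L^2(0,T)};\qquad \mathcal{L}_Tw(t):=\int_0^te^{-s/T}\partial_sw(s)\,\mathrm{d}s .$$ $S_h^p(0,T)$ are finite dimensional subspaces of $H^2_{0,\bullet}(0,T)$, depending on a mesh parameter $h>0$ and a polynomial degree $p\in\mathbb{N}_0$. Assumption A: (i) there is a constant $C_I>0$, depending on $p$ but not on $h$, such that for all $w_h\in S_h^p(0,T)$: $\|w_h\|_{H^2_{0,\bullet}(0,T)}\le C_Ih^{-1}\|\partial_tw_h\|_{L^2(0,T)}$ and $\|\partial_tw_h\|_{L^2(0,T)}\le C_Ih^{-1}\|w_h\|_{L^2(0,T)}$. (ii) There is a constant $C_a>0$, depending on $p$ but not on $h$, such that, for each $w\in H^2_{0,\bullet}(0,T)\cap H^{s+1}(0,T)$ and $\ell\le s\le p$, there is a function $\widetilde w_h\in S_h^p(0,T)$ satisfying $\|\partial_t^\ell w-\partial_t^\ell\widetilde w_h\|_{L^2(0,T)}\le C_ah^{s+1-\ell}\|\partial_t^{s+1}w\|_{L^2(0,T)}$, $\ell=0,1,2$, and, if $w\in W^{s+1}_\infty(0,T)$, also $\|\partial_tw-\partial_t\widetilde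 w_h\|_{L^\infty(0,T)}\le C_ah^s\|\partial_t^{s+1}w\|_{L^\infty(0,T)}$. Assumption B: there exists a projection operator $Q_h:H^2_{0,\bullet}(0,T)\to S_h^p(0,T)$ such that $\partial_tQ_hu(T)=\partial_tu(T)$ and $(\partial_tQ_hu,e^{-\bullet/T}\partial_t^2w_h)_{L^2(0,T)}=(\partial_tu,e^{-\bullet/T}\partial_t^2w_h)_{L^2(0,T)}$ for all $w_h\in S_h^p(0,T)$, where $e^{-\bullet/T}$ is the function $t\mapsto e^{-t/T}$; and such that, for every $u$ sufficiently smooth, $\|\partial_tu-\partial_tQ_hu\|_{L^2(0,T)}\le Ch^p$ with a constant $C>0$ depending on $u$ but independent of $h$. "Sufficiently smooth" means having enough (unspecified) additional regularity on $[0,T]$.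
   Formalization: The polynomial degree is assumed to satisfy p ≥ 2: for p = 0, 1 Assumption A(ii) gives no estimate for ℓ = 2 and the claim fails for suitably perturbed spline spaces; h ranges over a given set of positive mesh sizes. *)

theory Defs
  imports "HOL-Analysis.Analysis" "HOL-Probability.Essential_Supremum"
begin

text \<open>
  Elements of function spaces on the interval \<open>(0,T)\<close> are represented by functions on the whole
  real line; only their values on \<open>(0,T)\<close>, up to null sets, matter.
\<close>

abbreviation leb :: "real \<Rightarrow> real measure" where
  "leb T \<equiv> lebesgue_on {0<..<T}"

definition ae_eq :: "real \<Rightarrow> (real \<Rightarrow> real) \<Rightarrow> (real \<Rightarrow> real) \<Rightarrow> bool" where
  "ae_eq T f g \<longleftrightarrow> (AE t in leb T. f t = g t)"

definition L2_space :: "real \<Rightarrow> (real \<Rightarrow> real) set" where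
  "L2_space T = {f \<in> borel_measurable (leb T). integrable (leb T) (\<lambda>t. (f t)\<^sup>2)}"

definition L2_inner :: "real \<Rightarrow> (real \<Rightarrow> real) \<Rightarrow> (real \<Rightarrow> real) \<Rightarrow> real" where
  "L2_inner T f g = (LINT t|leb T. f t * g t)"

definition L2_norm :: "real \<Rightarrow> (real \<Rightarrow> real) \<Rightarrow> real" where
  "L2_norm T f = sqrt (L2_inner T f f)"

definition Linf_norm :: "real \<Rightarrow> (real \<Rightarrow> real) \<Rightarrow> ereal" where
  "Linf_norm T f = esssup (leb T) (\<lambda>t. ereal \<bar>f t\<bar>)"

definition Linf_space :: "real \<Rightarrow> (real \<Rightarrow> real) set" where
  "Linf_space T = {f \<in> borel_measurable (leb T). Linf_norm T f < \<infinity>}"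

text \<open>The test functions \<open>C\<^sub>c\<^sup>\<infinity>(0,T)\<close>.\<close>

definition test_functions :: "real \<Rightarrow> (real \<Rightarrow> real) set" where
  "test_functions T =
     {\<phi>. (\<forall>n x. (deriv ^^ n) \<phi> differentiable (at x)) \<and> closure {t. \<phi> t \<noteq> 0} \<subseteq> {0<..<T}}"

definition locally_integrable :: "real \<Rightarrow> (real \<Rightarrow> real) \<Rightarrow> bool" where
  "locally_integrable T f \<longleftrightarrow>
     (\<forall>a b. 0 < a \<longrightarrow> a \<le> b \<longrightarrow> b < T \<longrightarrow> f absolutely_integrable_on {a..b})"

definition is_weak_deriv :: "real \<Rightarrow> nat \<Rightarrow> (real \<Rightarrow> real) \<Rightarrow> (real \<Rightarrow> real) \<Rightarrow> bool" where
  "is_weak_deriv T k f g \<longleftrightarrow>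
     locally_integrable T f \<and> locally_integrable T g \<and>
     (\<forall>\<phi>\<in>test_functions T. L2_inner T f ((deriv ^^ k) \<phi>) = (- 1) ^ k * L2_inner T g \<phi>)"

text \<open>
  A representative of the weak derivative of order \<open>k\<close>. It is determined up to null sets only, also
  for \<open>k = 0\<close>, and meaningful only if a weak derivative exists.
\<close>

definition wderiv :: "real \<Rightarrow> nat \<Rightarrow> (real \<Rightarrow> real) \<Rightarrow> (real \<Rightarrow> real)" where
  "wderiv T k f = (SOME g. is_weak_deriv T k f g)"

definition sobolev_over :: "(real \<Rightarrow> real) set \<Rightarrow> real \<Rightarrow> nat \<Rightarrow> (real \<Rightarrow> real) set" where
  "sobolev_over X T k = {f \<in> X. \<forall>j\<le>k. \<exists>g\<in>X. is_weak_deriv T j f g}"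

abbreviation Hk :: "real \<Rightarrow> nat \<Rightarrow> (real \<Rightarrow> real) set" where
  "Hk T k \<equiv> sobolev_over (L2_space T) T k"

abbreviation Wk_inf :: "real \<Rightarrow> nat \<Rightarrow> (real \<Rightarrow> real) set" where
  "Wk_inf T k \<equiv> sobolev_over (Linf_space T) T k"

text \<open>
  The value at \<open>x \<in> [0,T]\<close> of the (unique) representative of \<open>f\<close> that is continuous on \<open>[0,T]\<close>;
  meaningful only if there is one, as for \<open>f \<in> H\<^sup>1(0,T)\<close>.
\<close>

definition trace_at :: "real \<Rightarrow> (real \<Rightarrow> real) \<Rightarrow> real \<Rightarrow> real" where
  "trace_at T f x = (THE y. \<exists>g. continuous_on {0..T} g \<and> ae_eq T f g \<and> y = g x)"

definition H20 :: "real \<Rightarrow> (real \<Rightarrow> real) set" where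
  "H20 T = {u \<in> Hk T 2. trace_at T u 0 = 0}"

definition H20_norm :: "real \<Rightarrow> (real \<Rightarrow> real) \<Rightarrow> real" where
  "H20_norm T u = L2_norm T (wderiv T 2 u) + 1 / T * L2_norm T (wderiv T 1 u)"

definition a_form :: "real \<Rightarrow> real \<Rightarrow> (real \<Rightarrow> real) \<Rightarrow> (real \<Rightarrow> real) \<Rightarrow> real" where
  "a_form T \<mu> u w =
     L2_inner T (wderiv T 2 u) (wderiv T 1 w)
     + trace_at T (wderiv T 1 u) 0 * trace_at T (wderiv T 1 w) 0
     + \<mu> * L2_inner T u (wderiv T 1 w)"

definition L_op :: "real \<Rightarrow> (real \<Rightarrow> real) \<Rightarrow> (real \<Rightarrow> real)" where
  "L_op T w = (\<lambda>t. LINT s|lebesgue_on {0..t}. exp (- s / T) * wderiv T 1 w s)"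

definition finite_dim_subspace :: "real \<Rightarrow> (real \<Rightarrow> real) set \<Rightarrow> bool" where
  "finite_dim_subspace T V \<longleftrightarrow>
     V \<subseteq> H20 T \<and>
     (\<exists>B. finite B \<and> V = {v. \<exists>c :: (real \<Rightarrow> real) \<Rightarrow> real. v = (\<lambda>t. \<Sum>b\<in>B. c b * b t)})"

text \<open>
  The discrete spaces \<open>S h\<close> are indexed by the mesh parameters \<open>h\<close> in a set \<open>H\<close> of positive reals.
  \<open>H\<close> must not be taken to be the set of all positive reals: the first inverse inequality below
  forces \<open>h \<le> C\<^sub>I T\<close> as soon as \<open>S h\<close> is nontrivial.
\<close>

definition inverse_inequalities :: "real \<Rightarrow> real set \<Rightarrow> (real \<Rightarrow> (real \<Rightarrow> real) set) \<Rightarrow> bool" where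
  "inverse_inequalities T H S \<longleftrightarrow>
     (\<exists>C>0. \<forall>h\<in>H. \<forall>w\<in>S h.
        H20_norm T w \<le> C * inverse h * L2_norm T (wderiv T 1 w) \<and>
        L2_norm T (wderiv T 1 w) \<le> C * inverse h * L2_norm T w)"

definition approximation_property ::
    "real \<Rightarrow> nat \<Rightarrow> real set \<Rightarrow> (real \<Rightarrow> (real \<Rightarrow> real) set) \<Rightarrow> bool" where
  "approximation_property T p H S \<longleftrightarrow>
     (\<exists>C>0. \<forall>h\<in>H. \<forall>s\<le>p. \<forall>w \<in> H20 T \<inter> Hk T (s + 1). \<exists>v\<in>S h.
        (\<forall>l\<in>{0, 1, 2}. l \<le> s \<longrightarrow>
           L2_norm T (\<lambda>t. wderiv T l w t - wderiv T l v t)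
             \<le> C * h ^ (s + 1 - l) * L2_norm T (wderiv T (s + 1) w)) \<and>
        (w \<in> Wk_inf T (s + 1) \<longrightarrow>
           Linf_norm T (\<lambda>t. wderiv T 1 w t - wderiv T 1 v t)
             \<le> ereal (C * h ^ s) * Linf_norm T (wderiv T (s + 1) w)))"

definition assumption_A ::
    "real \<Rightarrow> nat \<Rightarrow> real set \<Rightarrow> (real \<Rightarrow> (real \<Rightarrow> real) set) \<Rightarrow> bool" where
  "assumption_A T p H S \<longleftrightarrow> inverse_inequalities T H S \<and> approximation_property T p H S"

text \<open>
  Linear projections of \<open>H20 T\<close> onto \<open>V\<close>, acting on classes of almost everywhere equal functions.
\<close>

definition is_projection ::
    "real \<Rightarrow> (real \<Rightarrow> real) set \<Rightarrow> ((real \<Rightarrow> real) \<Rightarrow> (real \<Rightarrow> real)) \<Rightarrow> bool" where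
  "is_projection T V Q \<longleftrightarrow>
     (\<forall>u\<in>H20 T. Q u \<in> V) \<and>
     (\<forall>u\<in>H20 T. \<forall>v\<in>H20 T. ae_eq T u v \<longrightarrow> ae_eq T (Q u) (Q v)) \<and>
     (\<forall>u\<in>H20 T. \<forall>v\<in>H20 T. \<forall>a b.
        ae_eq T (Q (\<lambda>t. a * u t + b * v t)) (\<lambda>t. a * Q u t + b * Q v t)) \<and>
     (\<forall>v\<in>V. ae_eq T (Q v) v)"

text \<open>
  In the last clause, \<open>k\<close> is the unspecified regularity required of a ``sufficiently smooth'' \<open>u\<close>.
\<close>

definition assumption_B ::
    "real \<Rightarrow> nat \<Rightarrow> real set \<Rightarrow> (real \<Rightarrow> (real \<Rightarrow> real) set) \<Rightarrow> bool" where
  "assumption_B T p H S \<longleftrightarrow>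
     (\<exists>Q.
        (\<forall>h\<in>H. is_projection T (S h) (Q h)) \<and>
        (\<forall>h\<in>H. \<forall>u\<in>H20 T.
           trace_at T (wderiv T 1 (Q h u)) T = trace_at T (wderiv T 1 u) T \<and>
           (\<forall>w\<in>S h.
              L2_inner T (wderiv T 1 (Q h u)) (\<lambda>t. exp (- t / T) * wderiv T 2 w t)
              = L2_inner T (wderiv T 1 u) (\<lambda>t. exp (- t / T) * wderiv T 2 w t))) \<and>
        (\<exists>k. \<forall>u \<in> H20 T \<inter> Hk T k. \<exists>C>0. \<forall>h\<in>H.
           L2_norm T (\<lambda>t. wderiv T 1 u t - wderiv T 1 (Q h u) t) \<le> C * h ^ p))"

end

theory Submission
  imports Defs
begin

text \<open>
  Let \<open>e = u - u\<^sub>h\<close>. Testing with \<open>\<L>\<^sub>T w\<close> gives \<open>(\<L>\<^sub>T w)' = exp (-t / T) w'\<close>, and integration by parts shows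
  \<open>a\<^sub>\<mu>(w, \<L>\<^sub>T w) \<ge> c \<parallel>w'\<parallel>\<^sup>2\<close>. By the two defining properties of \<open>Q\<^sub>h\<close>, the form
  \<open>a\<^sub>\<mu>(u - Q\<^sub>h u, \<L>\<^sub>T w\<^sub>h)\<close> contains no second derivative and no boundary term after integration by parts, so
  Galerkin orthogonality bounds \<open>(u\<^sub>h - Q\<^sub>h u)'\<close> by \<open>(u - Q\<^sub>h u)'\<close>. This is the case \<open>l = 1\<close>; the case
  \<open>l = 2\<close> follows by the inverse inequality. For \<open>l = 0\<close>, let \<open>q'' + \<mu> q = e\<close> with \<open>q(T) = q'(T) = 0\<close> and
  \<open>z' = exp (t / T) q\<close>, \<open>z(0) = 0\<close>; then \<open>\<parallel>e\<parallel>\<^sup>2 = a\<^sub>\<mu>(e, \<L>\<^sub>T z) = a\<^sub>\<mu>(e, \<L>\<^sub>T (z - z\<^sub>h))\<close>, and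
  the term \<open>e'(0) (z - z\<^sub>h)'(0)\<close> is of the right order by the multiplicative trace inequality. If \<open>h > C\<^sub>I T\<close>,
  the inverse inequality makes the discrete space trivial, and approximation alone gives the case \<open>l = 0\<close>.
\<close>

section \<open>Smooth cutoffs\<close>

text \<open>Coercivity comes from the weight: \<open>exp (- t / T)\<close> decreases, so integrating
  the derivative of a square against it leaves a positive bulk term. The form's own boundary term at
  0 outweighs the negative one from integration by parts, and the same identity for u, with u(0) =
  0, gives the \<mu> term a sign. Hence neither \<mu> nor h has to be small. In the duality step an
  additive trace bound would lose half a power of h in each factor of the boundary product. Bounding
  F(0)^2 by |F|^2/T + 2|F||F'| recovers both halves; its first summand is comparable with the second
  only for bounded h, hence the case distinction at h = C_I T. The technical obstacle is that
  \<open>wderiv\<close> is a choice up to null sets, while traces are point values. All functions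
  are therefore replaced by absolutely continuous representatives paired with an L^2 derivative.
  Reaching such pairs from weak derivatives requires a supply of test functions. Calculus with them
  rests on an integration by parts derived from Fubini, since pointwise derivatives exist only
  almost everywhere.\<close>

fun differentiable_upto :: "nat \<Rightarrow> (real \<Rightarrow> real) \<Rightarrow> bool" where
  "differentiable_upto 0 f \<longleftrightarrow> (\<forall>x. f differentiable at x)"
| "differentiable_upto (Suc n) f \<longleftrightarrow> (\<forall>x. f differentiable at x) \<and> differentiable_upto n (deriv f)"

definition smooth :: "(real \<Rightarrow> real) \<Rightarrow> bool" where
  "smooth f \<longleftrightarrow> (\<forall>n. differentiable_upto n f)"

lemma differentiable_upto_imp_differentiable:
  "differentiable_upto n f \<Longrightarrow> f differentiable at x"
  by (cases n) auto

lemma differentiable_upto_lower: "differentiable_upto (Suc n) f \<Longrightarrow> differentiable_upto n f"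
proof (induction n arbitrary: f)
  case (Suc n)
  then have "differentiable_upto n (deriv f)"
    by (metis differentiable_upto.simps(2))
  with Suc.prems show ?case
    by simp
qed simp

lemma differentiable_upto_has_deriv:
  "differentiable_upto n f \<Longrightarrow> (f has_real_derivative deriv f x) (at x)"
  using DERIV_deriv_iff_real_differentiable differentiable_upto_imp_differentiable by blast

text \<open>The recursion of \<open>differentiable_upto\<close> strips derivatives from the inside,
  which suits inductions with f generalised, whereas \<open>deriv ^^ n\<close> adds them on the
  outside. Index n means n + 1 derivatives.\<close>

lemma smooth_iff_iterated: "smooth f \<longleftrightarrow> (\<forall>n x. (deriv ^^ n) f differentiable at x)"
proof -
  have "differentiable_upto n f \<longleftrightarrow> (\<forall>k\<le>n. \<forall>x. (deriv ^^ k) f differentiable at x)" for n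
  proof (induction n arbitrary: f)
    case (Suc n)
    have "(\<forall>k\<le>Suc n. \<forall>x. (deriv ^^ k) f differentiable at x) \<longleftrightarrow>
      (\<forall>x. f differentiable at x) \<and> (\<forall>k\<le>n. \<forall>x. (deriv ^^ Suc k) f differentiable at x)"
      by (metis (no_types, lifting) Suc_le_mono bot_nat_0.extremum eq_id_iff funpow_0 not0_implies_Suc)
    then show ?case
      using Suc by (simp add: funpow_swap1)
  qed auto
  then show ?thesis
    unfolding smooth_def by blast
qed

lemma differentiable_upto_add:
  "differentiable_upto n f \<Longrightarrow> differentiable_upto n g \<Longrightarrow> differentiable_upto n (\<lambda>x. f x + g x)"
proof (induction n arbitrary: f g)
  case (Suc n)
  have "deriv (\<lambda>x. f x + g x) = (\<lambda>x. deriv f x + deriv g x)"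
    using Suc.prems by (intro ext DERIV_imp_deriv DERIV_add differentiable_upto_has_deriv)
  then show ?case
    using Suc by auto
qed auto

lemma differentiable_upto_cmult:
  "differentiable_upto n f \<Longrightarrow> differentiable_upto n (\<lambda>x. c * f x)"
proof (induction n arbitrary: f)
  case (Suc n)
  have "deriv (\<lambda>x. c * f x) = (\<lambda>x. c * deriv f x)"
    using Suc.prems by (intro ext DERIV_imp_deriv DERIV_cmult differentiable_upto_has_deriv)
  then show ?case
    using Suc by auto
qed auto

text \<open>The product rule leaves undifferentiated factors, so the hypotheses are also used at the
  lower index.\<close>

lemma differentiable_upto_mult:
  "differentiable_upto n f \<Longrightarrow> differentiable_upto n g \<Longrightarrow> differentiable_upto n (\<lambda>x. f x * g x)"
proof (induction n arbitrary: f g)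
  case (Suc n)
  have "deriv (\<lambda>x. f x * g x) = (\<lambda>x. deriv f x * g x + deriv g x * f x)"
    using Suc.prems by (intro ext DERIV_imp_deriv DERIV_mult differentiable_upto_has_deriv)
  moreover have "differentiable_upto n (\<lambda>x. deriv f x * g x + deriv g x * f x)"
    using Suc by (intro differentiable_upto_add Suc.IH) (auto intro: differentiable_upto_lower)
  ultimately show ?case
    using Suc by auto
qed auto

lemma differentiable_upto_affine:
  "differentiable_upto n f \<Longrightarrow> differentiable_upto n (\<lambda>x. f (c * x + d))"
proof (induction n arbitrary: f)
  case 0
  have "((\<lambda>x. f (c * x + d)) has_real_derivative deriv f (c * x + d) * c) (at x)" for x
    by (rule DERIV_chain2[where f=f])
       (use 0 in \<open>auto intro!: derivative_eq_intros differentiable_upto_has_deriv[of 0]\<close>)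
  then show ?case
    using real_differentiable_def by auto
next
  case (Suc n)
  have D: "((\<lambda>x. f (c * x + d)) has_real_derivative deriv f (c * x + d) * c) (at x)" for x
    by (rule DERIV_chain2[where f=f])
       (use Suc.prems in \<open>auto intro!: derivative_eq_intros differentiable_upto_has_deriv[of "Suc n"]\<close>)
  then have "deriv (\<lambda>x. f (c * x + d)) = (\<lambda>x. c * deriv f (c * x + d))"
    by (metis (no_types) DERIV_imp_deriv ext mult.commute)
  moreover have "differentiable_upto n (\<lambda>x. c * deriv f (c * x + d))"
    using Suc by (intro differentiable_upto_cmult Suc.IH) auto
  ultimately show ?case
    using D real_differentiable_def by auto
qed

lemma smooth_add: "smooth f \<Longrightarrow> smooth g \<Longrightarrow> smooth (\<lambda>x. f x + g x)"
  and smooth_cmult: "smooth f \<Longrightarrow> smooth (\<lambda>x. c * f x)"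
  and smooth_mult: "smooth f \<Longrightarrow> smooth g \<Longrightarrow> smooth (\<lambda>x. f x * g x)"
  and smooth_affine: "smooth f \<Longrightarrow> smooth (\<lambda>x. f (c * x + d))"
  by (simp_all add: smooth_def differentiable_upto_add differentiable_upto_cmult
      differentiable_upto_mult differentiable_upto_affine)

lemma smooth_deriv: "smooth f \<Longrightarrow> smooth (deriv f)"
  unfolding smooth_def by (metis differentiable_upto.simps(2))

lemma smooth_has_deriv: "smooth f \<Longrightarrow> (f has_real_derivative deriv f x) (at x)"
  using differentiable_upto_has_deriv smooth_def by blast

lemma smooth_antideriv:
  assumes "\<And>x. (f has_real_derivative g x) (at x)" "smooth g"
  shows "smooth f"
proof -
  have "deriv f = g"
    using assms(1) by (intro ext DERIV_imp_deriv)
  then have "differentiable_upto n f" for n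
    using assms by (cases n) (auto simp: smooth_def real_differentiable_def)
  then show ?thesis
    by (simp add: smooth_def)
qed

lemma smooth_continuous_on: "smooth f \<Longrightarrow> continuous_on A f"
  by (meson DERIV_continuous_on has_field_derivative_at_within smooth_has_deriv)

section \<open>Flat functions and bump functions\<close>

definition flat_poly :: "real poly \<Rightarrow> real \<Rightarrow> real" where
  "flat_poly P x = (if x > 0 then poly P (1 / x) * exp (- (1 / x)) else 0)"

lemma poly_exp_minus_tendsto_0: "((\<lambda>y::real. poly P y * exp (- y)) \<longlongrightarrow> 0) at_top"
proof -
  have "((\<lambda>y. \<Sum>i\<le>degree P. coeff P i * (y ^ i / exp y)) \<longlongrightarrow> (\<Sum>i\<le>degree P. coeff P i * 0)) at_top"
    by (intro tendsto_sum tendsto_mult tendsto_const tendsto_power_div_exp_0)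
  then show ?thesis
    by (simp add: poly_altdef sum_distrib_right exp_minus divide_inverse mult.assoc)
qed

text \<open>Carrying a polynomial P in y = 1/x closes the family under differentiation: the new
  factor is y^2 (P - P')(y), so smoothness becomes a plain induction.\<close>

lemma flat_poly_has_deriv:
  "(flat_poly P has_real_derivative flat_poly ([:0, 0, 1:] * (P - pderiv P)) x) (at x)"
proof (cases x "0::real" rule: linorder_cases)
  case less
  have "((\<lambda>_. 0) has_real_derivative 0) (at x)"
    by simp
  then have "(flat_poly P has_real_derivative 0) (at x)"
    by (rule has_field_derivative_transform_within_open[where S="{..<0}"])
       (use less in \<open>auto simp: flat_poly_def\<close>)
  then show ?thesis
    using less by (simp add: flat_poly_def)
next
  case greater
  have "((\<lambda>x. poly P (1 / x) * exp (- (1 / x))) has_real_derivative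
      poly P (1 / x) * (exp (- (1 / x)) * (1 / x\<^sup>2)) + poly (pderiv P) (1 / x) * (- (1 / x\<^sup>2)) * exp (- (1 / x))) (at x)"
    using greater
    by (auto intro!: derivative_eq_intros DERIV_chain2[OF poly_DERIV] simp: power2_eq_square divide_simps)
  then have "(flat_poly P has_real_derivative
      poly P (1 / x) * (exp (- (1 / x)) * (1 / x\<^sup>2)) + poly (pderiv P) (1 / x) * (- (1 / x\<^sup>2)) * exp (- (1 / x))) (at x)"
    by (rule has_field_derivative_transform_within_open[where S="{0<..}"])
       (use greater in \<open>auto simp: flat_poly_def\<close>)
  then show ?thesis
    using greater by (simp add: flat_poly_def power2_eq_square algebra_simps)
next
  case equal
  \<comment> \<open>In the difference quotient at 0, division by x multiplies the polynomial by y =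
    1/x.\<close>
  have "((\<lambda>y. poly ([:0, 1:] * P) y * exp (- y)) \<longlongrightarrow> 0) at_top"
    by (rule poly_exp_minus_tendsto_0)
  then have "((\<lambda>x. poly ([:0, 1:] * P) (1 / x) * exp (- (1 / x))) \<longlongrightarrow> 0) (at_right (0::real))"
    by (rule filterlim_compose[where f="\<lambda>x. 1 / x"])
       (simp add: filterlim_inverse_at_top_right flip: inverse_eq_divide)
  then have R: "((\<lambda>x. flat_poly P x / x) \<longlongrightarrow> 0) (at_right (0::real))"
    by (rule tendsto_cong[THEN iffD1, rotated])
       (auto simp: eventually_at_filter flat_poly_def)
  have "((\<lambda>x. 0) \<longlongrightarrow> 0) (at_left (0::real))"
    by simp
  then have L: "((\<lambda>x. flat_poly P x / x) \<longlongrightarrow> 0) (at_left (0::real))"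
    by (rule tendsto_cong[THEN iffD1, rotated])
       (auto simp: eventually_at_filter flat_poly_def)
  have "((\<lambda>x. flat_poly P x / x) \<longlongrightarrow> 0) (at 0)"
    using L R by (simp add: filterlim_at_split)
  then have "(flat_poly P has_real_derivative 0) (at 0)"
    by (simp add: has_field_derivative_iff flat_poly_def[of _ 0])
  then show ?thesis
    by (simp add: equal flat_poly_def)
qed

lemma smooth_flat_poly: "smooth (flat_poly P)"
proof -
  have "differentiable_upto n (flat_poly P)" for n
  proof (induction n arbitrary: P)
    case 0
    show ?case
      using flat_poly_has_deriv by (auto simp: real_differentiable_def)
  next
    case (Suc n)
    have "deriv (flat_poly P) = flat_poly ([:0, 0, 1:] * (P - pderiv P))"
      by (intro ext DERIV_imp_deriv flat_poly_has_deriv)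
    then show ?case
      using Suc flat_poly_has_deriv by (auto simp: real_differentiable_def)
  qed
  then show ?thesis
    by (simp add: smooth_def)
qed

text \<open>The factor \<open>Suc n\<close> sends both exponents to 0 inside the interval, so the
  limit is the indicator of the open interval. The arguments are spelled out as affine maps to fit
  \<open>smooth_affine\<close>.\<close>

definition cutoff :: "real \<Rightarrow> real \<Rightarrow> nat \<Rightarrow> real \<Rightarrow> real" where
  "cutoff a b n x =
     flat_poly 1 (real (Suc n) * x + - (real (Suc n) * a)) * flat_poly 1 (- real (Suc n) * x + real (Suc n) * b)"

lemma smooth_cutoff: "smooth (cutoff a b n)"
  unfolding cutoff_def[abs_def] by (intro smooth_mult smooth_affine smooth_flat_poly)

lemma cutoff_eq:
  "cutoff a b n x =
     (if a < x \<and> x < b then exp (- (1 / (real (Suc n) * (x - a)))) * exp (- (1 / (real (Suc n) * (b - x)))) else 0)"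
proof -
  have "real (Suc n) * x + - (real (Suc n) * a) = real (Suc n) * (x - a)"
    "- real (Suc n) * x + real (Suc n) * b = real (Suc n) * (b - x)"
    by (simp_all add: algebra_simps)
  then show ?thesis
    unfolding cutoff_def flat_poly_def by (simp only: zero_less_mult_iff) auto
qed

lemma cutoff_nonneg: "0 \<le> cutoff a b n x" and cutoff_le_1: "cutoff a b n x \<le> 1"
  by (auto simp: cutoff_eq intro!: mult_le_one)

lemma cutoff_tendsto_indicator: "(\<lambda>n. cutoff a b n x) \<longlonglongrightarrow> indicator {a<..<b} x"
proof (cases "a < x \<and> x < b")
  case True
  have *: "(\<lambda>n. 1 / (real (Suc n) * y)) \<longlonglongrightarrow> 0" if "0 < y" for y
  proof -
    have "(\<lambda>n. inverse (real (Suc n)) * (1 / y)) \<longlonglongrightarrow> 0 * (1 / y)"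
      by (intro tendsto_mult LIMSEQ_inverse_real_of_nat tendsto_const)
    then show ?thesis
      by (simp add: divide_simps)
  qed
  have "(\<lambda>n. exp (- (1 / (real (Suc n) * (x - a)))) * exp (- (1 / (real (Suc n) * (b - x))))) \<longlonglongrightarrow> exp (- 0) * exp (- 0)"
    using True by (intro tendsto_mult tendsto_exp tendsto_minus *) auto
  then show ?thesis
    using True by (simp add: cutoff_eq)
qed (auto simp: cutoff_eq)

section \<open>Test functions and their supports\<close>

lemma test_functionsI:
  assumes "smooth \<phi>" "0 < a" "b < T" "\<And>x. x \<notin> {a..b} \<Longrightarrow> \<phi> x = 0"
  shows "\<phi> \<in> test_functions T"
proof -
  have "{t. \<phi> t \<noteq> 0} \<subseteq> {a..b}"
    using assms(4) by blast
  then have "closure {t. \<phi> t \<noteq> 0} \<subseteq> {a..b}"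
    by (rule closure_minimal) simp
  with assms show ?thesis
    unfolding test_functions_def by (auto simp flip: smooth_iff_iterated)
qed

lemma test_functionsE:
  assumes "\<phi> \<in> test_functions T" "0 < T"
  obtains a b where "smooth \<phi>" "0 < a" "a < b" "b < T" "\<And>x. x \<notin> {a..b} \<Longrightarrow> \<phi> x = 0"
proof -
  let ?K = "closure {t. \<phi> t \<noteq> 0}"
  have sm: "smooth \<phi>" and sub: "?K \<subseteq> {0<..<T}"
    using assms unfolding test_functions_def by (auto simp: smooth_iff_iterated)
  have comp: "compact ?K"
    by (rule compact_eq_bounded_closed[THEN iffD2], rule conjI)
      (rule bounded_subset[OF bounded_box[of 0 T, unfolded box_real] sub], rule closed_closure)
  show ?thesis
  proof (cases "?K = {}")
    case True
    then have "{t. \<phi> t \<noteq> 0} = {}"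
      using closure_subset[of "{t. \<phi> t \<noteq> 0}"] by simp
    then have "\<phi> x = 0" for x
      by blast
    with sm \<open>0 < T\<close> show ?thesis
      by (intro that[of "T / 3" "2 * T / 3"]) simp_all
  next
    case False
    obtain s where s: "s \<in> ?K" "\<forall>x\<in>?K. s \<le> x"
      using compact_attains_inf[OF comp False] by blast
    obtain t where t: "t \<in> ?K" "\<forall>x\<in>?K. x \<le> t"
      using compact_attains_sup[OF comp False] by blast
    \<comment> \<open>Halving the left end gives a < b without showing that the support has more
      than one point.\<close>
    have "\<phi> x = 0" if "x \<notin> {s / 2..t}" for x
    proof (rule ccontr)
      assume "\<phi> x \<noteq> 0"
      then have "x \<in> ?K"
        using subsetD[OF closure_subset, of x "{t. \<phi> t \<noteq> 0}"] by simp
      then have "s \<le> x" "x \<le> t"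
        using bspec[OF s(2)] bspec[OF t(2)] by blast+
      moreover have "0 < s"
        using subsetD[OF sub s(1)] by simp
      ultimately show False
        using that by auto
    qed
    moreover have "0 < s" "s \<le> t" "t < T"
      using subsetD[OF sub s(1)] subsetD[OF sub t(1)] bspec[OF s(2) t(1)] by simp_all
    ultimately show ?thesis
      using sm by (intro that[of "s / 2" t]) auto
  qed
qed

lemma cutoff_test: "0 < a \<Longrightarrow> b < T \<Longrightarrow> cutoff a b n \<in> test_functions T"
  by (rule test_functionsI[OF smooth_cutoff]) (auto simp: cutoff_eq)

lemma test_functions_add:
  assumes "\<phi> \<in> test_functions T" "\<psi> \<in> test_functions T" "0 < T"
  shows "(\<lambda>x. \<phi> x + c * \<psi> x) \<in> test_functions T"
proof -
  obtain a b where 1: "smooth \<phi>" "0 < a" "a < b" "b < T" "\<And>x. x \<notin> {a..b} \<Longrightarrow> \<phi> x = 0"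
    using test_functionsE[OF assms(1,3)] by metis
  obtain a' b' where 2: "smooth \<psi>" "0 < a'" "a' < b'" "b' < T" "\<And>x. x \<notin> {a'..b'} \<Longrightarrow> \<psi> x = 0"
    using test_functionsE[OF assms(2,3)] by metis
  show ?thesis
  proof (rule test_functionsI[where a="min a a'" and b="max b b'"])
    show "\<phi> x + c * \<psi> x = 0" if "x \<notin> {min a a'..max b b'}" for x
    proof -
      have "x \<notin> {a..b}" "x \<notin> {a'..b'}"
        using that by auto
      then show ?thesis
        using 1(5) 2(5) by simp
    qed
  qed (use 1 2 in \<open>auto intro: smooth_add smooth_cmult\<close>)
qed

lemma test_functions_deriv:
  assumes "\<phi> \<in> test_functions T" "0 < T"
  shows "deriv \<phi> \<in> test_functions T"
proof -
  obtain a b where 1: "smooth \<phi>" "0 < a" "a < b" "b < T" "\<And>x. x \<notin> {a..b} \<Longrightarrow> \<phi> x = 0"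
    using test_functionsE[OF assms] by metis
  have "deriv \<phi> x = 0" if x: "x \<notin> {a..b}" for x
  proof -
    have "((\<lambda>_. 0) has_real_derivative 0) (at x)"
      by simp
    then have "(\<phi> has_real_derivative 0) (at x)"
      by (rule has_field_derivative_transform_within_open[where S="- {a..b}"]) (use 1 x in auto)
    then show ?thesis
      by (rule DERIV_imp_deriv)
  qed
  with 1 show ?thesis
    by (intro test_functionsI[where a=a and b=b] smooth_deriv)
qed

section \<open>Weak derivatives\<close>

text \<open>Weak derivatives are tested with Bochner integrals over (0,T), while limits and
  primitives are handled by gauge integrals on compact intervals. Functions vanishing off
  \<open>{a..b}\<close> pass between the two even when f is only locally integrable.\<close>

lemma LINT_leb_eq_integral:
  fixes h :: "real \<Rightarrow> real"
  assumes "h absolutely_integrable_on {a..b}" "0 < a" "b < T" "\<And>x. x \<notin> {a..b} \<Longrightarrow> h x = 0"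
  shows "integrable (leb T) h" "(LINT t|leb T. h t) = integral {a..b} h"
proof -
  have eq: "(\<lambda>x. indicator {0<..<T} x *\<^sub>R h x) = (\<lambda>x. indicator {a..b} x *\<^sub>R h x)"
    using assms(2-4) by (force simp: indicator_def)
  show "integrable (leb T) h"
    using assms(1) unfolding set_integrable_def by (subst integrable_restrict_space) (simp_all only: eq, simp)
  have "(LINT t|leb T. h t) = (LINT t:{a..b}|lebesgue. h t)"
    unfolding set_lebesgue_integral_def by (subst integral_restrict_space) (simp_all only: eq, simp)
  then show "(LINT t|leb T. h t) = integral {a..b} h"
    using set_lebesgue_integral_eq_integral(2)[OF assms(1)] by simp
qed

lemma locally_integrable_test_integrable:
  assumes "locally_integrable T f" "\<phi> \<in> test_functions T" "0 < T"
  shows "integrable (leb T) (\<lambda>t. f t * \<phi> t)"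
proof -
  obtain a b where 1: "smooth \<phi>" "0 < a" "a < b" "b < T" "\<And>x. x \<notin> {a..b} \<Longrightarrow> \<phi> x = 0"
    using test_functionsE[OF assms(2,3)] by metis
  have "f absolutely_integrable_on {a..b}"
    using assms(1) 1 by (simp add: locally_integrable_def)
  then have "(\<lambda>t. \<phi> t * f t) absolutely_integrable_on {a..b}"
    by (intro absolutely_integrable_bounded_measurable_product_real
        continuous_imp_measurable_on_sets_lebesgue smooth_continuous_on 1
        compact_imp_bounded compact_continuous_image) auto
  then show ?thesis
    using 1 by (intro LINT_leb_eq_integral(1)[where a=a and b=b]) (auto simp: mult.commute)
qed

lemma locally_integrable_add:
  "locally_integrable T f \<Longrightarrow> locally_integrable T g \<Longrightarrow> locally_integrable T (\<lambda>t. f t + c * g t)"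
  unfolding locally_integrable_def
  by (auto intro!: set_integral_add absolutely_integrable_scaleR_left)

lemma AE_leb_iff: "(AE t in leb T. P t) \<longleftrightarrow> (AE t in lebesgue. 0 < t \<and> t < T \<longrightarrow> P t)"
  by (subst AE_restrict_space_iff) auto

text \<open>The cutoffs turn the hypothesis into vanishing of all integrals over compact subintervals.\<close>

lemma fundamental_lemma:
  assumes "0 < T" "locally_integrable T f" "\<And>\<phi>. \<phi> \<in> test_functions T \<Longrightarrow> L2_inner T f \<phi> = 0"
  shows "AE t in leb T. f t = 0"
proof -
  have zero: "integral {a..b} f = 0" if ab: "0 < a" "b < T" for a b
  proof (cases "a \<le> b")
    case True
    have f: "f absolutely_integrable_on {a..b}"
      using assms(2) ab True by (simp add: locally_integrable_def)
    have prod: "(\<lambda>t. cutoff a b n t * f t) absolutely_integrable_on {a..b}" for n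
      by (intro absolutely_integrable_bounded_measurable_product_real f
          continuous_imp_measurable_on_sets_lebesgue smooth_continuous_on smooth_cutoff
          compact_imp_bounded compact_continuous_image) auto
    have int0: "integral {a..b} (\<lambda>t. cutoff a b n t * f t) = 0" for n
    proof -
      have "(LINT t|leb T. cutoff a b n t * f t) = integral {a..b} (\<lambda>t. cutoff a b n t * f t)"
        using prod ab by (intro LINT_leb_eq_integral(2)) (auto simp: cutoff_eq)
      then show ?thesis
        using assms(3)[OF cutoff_test[OF ab, of n]] by (simp add: L2_inner_def mult.commute)
    qed
    have "(\<lambda>n. integral {a..b} (\<lambda>t. cutoff a b n t * f t)) \<longlonglongrightarrow> integral {a..b} (\<lambda>t. indicator {a<..<b} t * f t)"
    proof (rule dominated_convergence)
      show "(\<lambda>t. cutoff a b n t * f t) integrable_on {a..b}" for n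
        using prod absolutely_integrable_on_def by blast
      show "(\<lambda>t. \<bar>f t\<bar>) integrable_on {a..b}"
        using f unfolding absolutely_integrable_on_def real_norm_def by (rule conjunct2)
      show "norm (cutoff a b n t * f t) \<le> \<bar>f t\<bar>" for n t
        using cutoff_nonneg[of a b n t] cutoff_le_1[of a b n t]
        by (simp add: abs_mult mult_left_le_one_le)
      show "(\<lambda>n. cutoff a b n t * f t) \<longlonglongrightarrow> indicator {a<..<b} t * f t" for t
        by (intro tendsto_mult cutoff_tendsto_indicator tendsto_const)
    qed
    then have "integral {a..b} (\<lambda>t. indicator {a<..<b} t * f t) = 0"
      by (simp add: int0 LIMSEQ_const_iff)
    moreover have "integral {a..b} (\<lambda>t. indicator {a<..<b} t * f t) = integral {a..b} f"
      by (rule integral_spike[where S="{a, b}"]) auto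
    ultimately show ?thesis
      by simp
  qed simp
  have loc: "AE t in lebesgue. a \<le> t \<and> t < b \<longrightarrow> f t = 0" if ab: "0 < a" "b < T" for a b
  proof -
    \<comment> \<open>Lebesgue differentiation: all averages over \<open>[x, x + h]\<close> vanish,
      and off a negligible set they converge to the value at x. Extension by zero makes the function
      integrable over every box.\<close>
    let ?g = "\<lambda>x. if x \<in> {a..b} then f x else 0"
    have g: "(?g has_integral 0) (cbox c d)" for c d
    proof (cases "max a c \<le> min b d")
      case True
      then have "f absolutely_integrable_on {max a c..min b d}"
        using assms(2) ab by (simp add: locally_integrable_def)
      then have "(f has_integral 0) {max a c..min b d}"
        using zero[of "max a c" "min b d"] ab
        by (simp add: has_integral_iff set_lebesgue_integral_eq_integral(1) less_max_iff_disj min_less_iff_disj)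
      moreover have "{max a c..min b d} = {a..b} \<inter> cbox c d"
        by (simp add: Int_atLeastAtMost)
      ultimately show ?thesis
        unfolding has_integral_restrict_Int by (simp only:)
    next
      case False
      then have "{a..b} \<inter> cbox c d = {}"
        by auto
      then have "(f has_integral 0) ({a..b} \<inter> cbox c d)"
        by simp
      then show ?thesis
        unfolding has_integral_restrict_Int .
    qed
    have g': "?g integrable_on cbox c d" "integral (cbox c d) ?g = 0" for c d
      by (rule has_integral_integrable[OF g], rule integral_unique[OF g])
    obtain N where N: "negligible N" and
      lim: "\<And>x e. \<lbrakk>x \<notin> N; 0 < e\<rbrakk> \<Longrightarrow> \<exists>d>0. \<forall>h. 0 < h \<and> h < d \<longrightarrow>
          norm (integral (cbox x (x + h *\<^sub>R One)) ?g /\<^sub>R h ^ DIM(real) - ?g x) < e"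
      by (rule integrable_ccontinuous_explicit[OF g'(1)]) blast
    have "f x = 0" if "x \<notin> N" "a \<le> x" "x < b" for x
    proof (rule ccontr)
      assume "f x \<noteq> 0"
      then obtain d where "d > 0" and d: "\<forall>h. 0 < h \<and> h < d \<longrightarrow>
          norm (integral (cbox x (x + h *\<^sub>R One)) ?g /\<^sub>R h ^ DIM(real) - ?g x) < \<bar>f x\<bar>"
        using lim[OF \<open>x \<notin> N\<close>, of "\<bar>f x\<bar>"] by auto
      then have "\<bar>?g x\<bar> < \<bar>f x\<bar>"
        using d[rule_format, of "d / 2"] g'(2) by simp
      then show False
        using that by simp
    qed
    then show ?thesis
      using N by (intro eventually_ae_filter_negligible[THEN iffD2] exI[of _ N]) auto
  qed
  \<comment> \<open>Countably many compact subintervals exhaust (0,T), so the union of the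
    exceptional sets is still null.\<close>
  have "AE t in lebesgue. \<forall>n. T / real (n + 2) \<le> t \<and> t < T - T / real (n + 2) \<longrightarrow> f t = 0"
    using \<open>0 < T\<close> by (intro AE_all_countable[THEN iffD2] allI loc) auto
  then have "AE t in lebesgue. 0 < t \<and> t < T \<longrightarrow> f t = 0"
  proof eventually_elim
    case (elim t)
    show ?case
    proof
      assume t: "0 < t \<and> t < T"
      then obtain n where n: "T / min t (T - t) < real n"
        using reals_Archimedean2 by blast
      define m where "m = min t (T - t)"
      have m: "0 < m" "m \<le> t" "m \<le> T - t"
        using t by (auto simp: m_def)
      have "T < m * real n"
        using n m by (simp add: m_def[symmetric] pos_divide_less_eq mult.commute)
      also have "\<dots> < m * real (n + 2)"
        using m by simp
      finally have "T < m * real (n + 2)" .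
      then have "T / real (n + 2) < m"
        by (simp only: pos_divide_less_eq of_nat_0_less_iff)
      then show "f t = 0"
        using elim[rule_format, of n] m by linarith
    qed
  qed
  then show ?thesis
    by (simp add: AE_leb_iff)
qed

lemma L2_inner_test_add:
  assumes "0 < T" "locally_integrable T f" "locally_integrable T g" "\<phi> \<in> test_functions T"
  shows "L2_inner T (\<lambda>t. f t + c * g t) \<phi> = L2_inner T f \<phi> + c * L2_inner T g \<phi>"
proof -
  have "(LINT t|leb T. f t * \<phi> t + c * (g t * \<phi> t)) = (LINT t|leb T. f t * \<phi> t) + c * (LINT t|leb T. g t * \<phi> t)"
    using assms by (subst Bochner_Integration.integral_add)
      (auto intro!: locally_integrable_test_integrable)
  then show ?thesis
    by (simp add: L2_inner_def algebra_simps)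
qed

lemma weak_deriv_unique:
  assumes "0 < T" "is_weak_deriv T k f g" "is_weak_deriv T k f g'"
  shows "ae_eq T g g'"
proof -
  have "AE t in leb T. g t + (- 1) * g' t = 0"
  proof (rule fundamental_lemma)
    show "locally_integrable T (\<lambda>t. g t + (- 1) * g' t)"
      using assms by (intro locally_integrable_add) (auto simp: is_weak_deriv_def)
    fix \<phi> assume "\<phi> \<in> test_functions T"
    then have "(- 1) ^ k * L2_inner T g \<phi> = (- 1) ^ k * L2_inner T g' \<phi>"
      using assms unfolding is_weak_deriv_def by metis
    then have "L2_inner T g \<phi> = L2_inner T g' \<phi>"
      by simp
    then show "L2_inner T (\<lambda>t. g t + (- 1) * g' t) \<phi> = 0"
      using assms \<open>\<phi> \<in> _\<close> by (subst L2_inner_test_add) (auto simp: is_weak_deriv_def)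
  qed fact
  then show ?thesis
    by (simp add: ae_eq_def)
qed

text \<open>The choice in \<open>wderiv\<close> is opened only here; from now on any weak derivative
  at hand may replace it up to a null set.\<close>

lemma wderiv_ae_eq:
  assumes "0 < T" "is_weak_deriv T k f g"
  shows "ae_eq T (wderiv T k f) g"
proof -
  have "is_weak_deriv T k f (wderiv T k f)"
    unfolding wderiv_def using assms(2) by (rule someI[of "is_weak_deriv T k f"])
  with assms show ?thesis
    by (intro weak_deriv_unique[of T k f])
qed

section \<open>The lemma of du Bois-Reymond\<close>

lemma test_functions_antideriv:
  assumes "0 < T" "\<psi> \<in> test_functions T" "(LINT t|leb T. \<psi> t) = 0"
  obtains \<phi> where "\<phi> \<in> test_functions T" "deriv \<phi> = \<psi>"
proof -
  obtain a b where 1: "smooth \<psi>" "0 < a" "a < b" "b < T" "\<And>x. x \<notin> {a..b} \<Longrightarrow> \<psi> x = 0"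
    using test_functionsE[OF assms(2,1)] by metis
  define \<phi> where "\<phi> x = integral {0..x} \<psi>" for x
  have ab0: "integral {a..b} \<psi> = 0"
    using LINT_leb_eq_integral(2)[where h=\<psi> and a=a and b=b and T=T] 1 assms(3)
    by (auto intro: absolutely_integrable_continuous_real smooth_continuous_on)
  have lo: "\<phi> x = 0" if "x < a" for x
  proof -
    have "integral {0..x} \<psi> = integral {0..x} (\<lambda>_. 0)"
      using 1 that by (intro integral_cong) auto
    then show ?thesis
      by (simp add: \<phi>_def)
  qed
  \<comment> \<open>Beyond the support the primitive equals the full integral, which is zero by the
    mean value condition.\<close>
  have hi: "\<phi> x = 0" if "x > b" for x
  proof -
    have "(\<psi> has_integral 0) {a..b}"
      using ab0 1(1) by (metis has_integral_integral integrable_continuous_real smooth_continuous_on)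
    then have "(\<psi> has_integral 0) {0..x}"
      by (rule has_integral_on_superset) (use 1 that in auto)
    then show ?thesis
      by (simp add: \<phi>_def integral_unique)
  qed
  have D: "(\<phi> has_real_derivative \<psi> x) (at x)" for x
  proof (cases "x < a")
    case True
    have "((\<lambda>_. 0) has_real_derivative 0) (at x)"
      by simp
    then have "(\<phi> has_real_derivative 0) (at x)"
      by (rule has_field_derivative_transform_within_open[where S="{..<a}"]) (use lo True in auto)
    then show ?thesis
      using 1 True by simp
  next
    case False
    \<comment> \<open>Since 0 < a \<le> x < x + 1, the point x is interior and the derivative within
      the interval is two-sided.\<close>
    have "((\<lambda>x. integral {0..x} \<psi>) has_real_derivative \<psi> x) (at x within {0..x + 1})"
      using 1 False by (intro integral_has_real_derivative smooth_continuous_on) auto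
    moreover have "at x within {0..x + 1} = at x"
      using 1 False by (intro at_within_interior) (auto simp: interior_atLeastAtMost_real)
    ultimately show ?thesis
      by (simp add: \<phi>_def[abs_def])
  qed
  show ?thesis
  proof
    show "\<phi> \<in> test_functions T"
      using 1 D lo hi by (intro test_functionsI[where a=a and b=b] smooth_antideriv[OF D]) auto
    show "deriv \<phi> = \<psi>"
      by (intro ext DERIV_imp_deriv D)
  qed
qed

lemma locally_integrable_const: "locally_integrable T (\<lambda>_. c)"
  by (auto simp: locally_integrable_def absolutely_integrable_continuous_real)

text \<open>With a fixed test function \<rho> of nonzero mean, every test function \<phi> differs
  from the derivative of a test function by a multiple of \<rho>. Hence f acts on \<phi> like a
  constant, and the fundamental lemma applies to the difference.\<close>

lemma du_Bois_Reymond: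
  assumes "0 < T" "locally_integrable T f" "\<And>\<phi>. \<phi> \<in> test_functions T \<Longrightarrow> L2_inner T f (deriv \<phi>) = 0"
  obtains c where "AE t in leb T. f t = c"
proof -
  \<comment> \<open>If all means vanished, the fundamental lemma would give 1 = 0 almost everywhere
    on an interval of positive length.\<close>
  have "\<exists>\<rho>\<in>test_functions T. L2_inner T (\<lambda>_. 1) \<rho> \<noteq> 0"
  proof (rule ccontr)
    assume "\<not> ?thesis"
    then have "AE t in leb T. (1::real) = 0"
      using fundamental_lemma[OF \<open>0 < T\<close> locally_integrable_const[of T 1]] by blast
    then have "eventually (\<lambda>_. False) (ae_filter (leb T))"
      by simp
    then have "emeasure (leb T) (space (leb T)) = 0"
      unfolding eventually_False ae_filter_eq_bot_iff .
    then have "emeasure lebesgue {0<..<T} = 0"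
      by (simp add: emeasure_restrict_space)
    then show False
      using \<open>0 < T\<close> by simp
  qed
  then obtain \<rho> where \<rho>: "\<rho> \<in> test_functions T" "L2_inner T (\<lambda>_. 1) \<rho> \<noteq> 0"
    by blast
  define c where "c = L2_inner T f \<rho> / L2_inner T (\<lambda>_. 1) \<rho>"
  have "AE t in leb T. f t + (- c) * 1 = 0"
  proof (rule fundamental_lemma)
    show "locally_integrable T (\<lambda>t. f t + (- c) * 1)"
      using assms locally_integrable_const by (intro locally_integrable_add)
    fix \<phi> assume \<phi>: "\<phi> \<in> test_functions T"
    define d where "d = - L2_inner T (\<lambda>_. 1) \<phi> / L2_inner T (\<lambda>_. 1) \<rho>"
    have add: "L2_inner T g (\<lambda>t. \<phi> t + d * \<rho> t) = L2_inner T g \<phi> + d * L2_inner T g \<rho>"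
      if "locally_integrable T g" for g
    proof -
      have "(LINT t|leb T. g t * \<phi> t + d * (g t * \<rho> t)) = (LINT t|leb T. g t * \<phi> t) + d * (LINT t|leb T. g t * \<rho> t)"
        using assms \<phi> \<rho> that by (subst Bochner_Integration.integral_add)
          (auto intro!: locally_integrable_test_integrable)
      then show ?thesis
        by (simp add: L2_inner_def algebra_simps)
    qed
    have "(LINT t|leb T. \<phi> t + d * \<rho> t) = 0"
      using add[OF locally_integrable_const[of T 1]] \<rho>(2) by (simp add: L2_inner_def d_def)
    then obtain \<Phi> where \<Phi>: "\<Phi> \<in> test_functions T" "deriv \<Phi> = (\<lambda>t. \<phi> t + d * \<rho> t)"
      using test_functions_antideriv[OF \<open>0 < T\<close> test_functions_add[OF \<phi> \<rho>(1) \<open>0 < T\<close>, of d]] by metis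
    then have "L2_inner T f \<phi> + d * L2_inner T f \<rho> = 0"
      using assms(3)[OF \<Phi>(1)] add[OF assms(2)] by simp
    then have "L2_inner T f \<phi> + (- c) * L2_inner T (\<lambda>_. 1) \<phi> = 0"
      by (simp add: c_def d_def field_simps)
    then show "L2_inner T (\<lambda>t. f t + (- c) * 1) \<phi> = 0"
      using assms \<phi> locally_integrable_const by (subst L2_inner_test_add) auto
  qed fact
  then show ?thesis
    by (intro that[of c]) simp
qed

section \<open>The space \<open>L\<^sup>2(0,T)\<close>\<close>

text \<open>The endpoints are null, so the open interval of \<open>leb\<close> may be exchanged for
  the closed one.\<close>

lemma integrable_leb_iff:
  fixes f :: "real \<Rightarrow> real"
  shows "integrable (leb T) f \<longleftrightarrow> f absolutely_integrable_on {0..T}"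
proof -
  have "integrable (leb T) f \<longleftrightarrow> f absolutely_integrable_on {0<..<T}"
    by (subst integrable_restrict_space) (simp_all add: set_integrable_def)
  then show ?thesis
    by (simp only: absolutely_integrable_on_Icc_iff_Ioo)
qed

lemma LINT_leb:
  fixes f :: "real \<Rightarrow> real"
  assumes "integrable (leb T) f"
  shows "(LINT t|leb T. f t) = integral {0..T} f"
  using lebesgue_integral_eq_integral[OF assms] integral_open_interval_real[of 0 T f] by simp

lemma borel_measurable_leb_iff:
  fixes f :: "real \<Rightarrow> real"
  shows "f \<in> borel_measurable (leb T) \<longleftrightarrow> (\<lambda>x. if x \<in> {0<..<T} then f x else 0) \<in> borel_measurable lebesgue"
  by (rule borel_measurable_if[symmetric]) simp

text \<open>By completeness of Lebesgue measure, changes on a null set keep measurability;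
  membership in \<open>L2_space\<close> is thus a property of the class.\<close>

lemma borel_measurable_leb_AE:
  fixes f :: "real \<Rightarrow> real"
  assumes "f \<in> borel_measurable (leb T)" "ae_eq T f g"
  shows "g \<in> borel_measurable (leb T)"
proof -
  have "AE x in lebesgue. (if x \<in> {0<..<T} then f x else 0) = (if x \<in> {0<..<T} then g x else 0)"
    using assms(2) unfolding ae_eq_def AE_leb_iff by eventually_elim simp
  then show ?thesis
    using assms(1) borel_measurable_AE[of "\<lambda>x. if x \<in> {0<..<T} then f x else 0" "\<lambda>x. if x \<in> {0<..<T} then g x else 0"]
    unfolding borel_measurable_leb_iff by simp
qed

lemma ae_eq_refl: "ae_eq T f f"
  and ae_eq_sym: "ae_eq T f g \<Longrightarrow> ae_eq T g f"
  and ae_eq_trans: "ae_eq T f g \<Longrightarrow> ae_eq T g h \<Longrightarrow> ae_eq T f h"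
  unfolding ae_eq_def by (auto elim: eventually_mono eventually_elim2)

lemma ae_eq_diff: "ae_eq T f f' \<Longrightarrow> ae_eq T g g' \<Longrightarrow> ae_eq T (\<lambda>t. f t - g t) (\<lambda>t. f' t - g' t)"
  unfolding ae_eq_def by (auto elim: eventually_elim2)

lemma ae_eq_mult:
  "ae_eq T f f' \<Longrightarrow> ae_eq T g g' \<Longrightarrow> ae_eq T (\<lambda>t. f t * g t) (\<lambda>t. f' t * g' t)"
  unfolding ae_eq_def by (auto elim: eventually_elim2)

lemma L2_spaceI:
  "f \<in> borel_measurable (leb T) \<Longrightarrow> integrable (leb T) (\<lambda>t. f t * f t) \<Longrightarrow> f \<in> L2_space T"
  by (simp add: L2_space_def power2_eq_square)

lemma L2_spaceD:
  assumes "f \<in> L2_space T"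
  shows "f \<in> borel_measurable (leb T)" "integrable (leb T) (\<lambda>t. f t * f t)"
  using assms by (simp_all add: L2_space_def power2_eq_square)

lemma L2_space_cong:
  assumes "f \<in> L2_space T" "ae_eq T f g"
  shows "g \<in> L2_space T"
proof (rule L2_spaceI)
  show g: "g \<in> borel_measurable (leb T)"
    using assms borel_measurable_leb_AE L2_spaceD(1) by blast
  show "integrable (leb T) (\<lambda>t. g t * g t)"
    by (rule integrable_cong_AE_imp[OF L2_spaceD(2)[OF assms(1)] borel_measurable_times[OF g g]
          ae_eq_mult[OF assms(2) assms(2), unfolded ae_eq_def]])
qed

lemma L2_inner_cong:
  assumes "f \<in> L2_space T" "g \<in> L2_space T" "ae_eq T f f'" "ae_eq T g g'"
  shows "L2_inner T f g = L2_inner T f' g'"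
  unfolding L2_inner_def
proof (rule integral_cong_AE)
  show "(\<lambda>t. f t * g t) \<in> borel_measurable (leb T)" "(\<lambda>t. f' t * g' t) \<in> borel_measurable (leb T)"
    using L2_spaceD(1)[OF assms(1)] L2_spaceD(1)[OF assms(2)]
      L2_spaceD(1)[OF L2_space_cong[OF assms(1,3)]] L2_spaceD(1)[OF L2_space_cong[OF assms(2,4)]]
    by (simp_all add: borel_measurable_times)
  show "AE t in leb T. f t * g t = f' t * g' t"
    using ae_eq_mult[OF assms(3,4)] by (simp add: ae_eq_def)
qed

lemma L2_norm_cong: "f \<in> L2_space T \<Longrightarrow> ae_eq T f f' \<Longrightarrow> L2_norm T f = L2_norm T f'"
  unfolding L2_norm_def using L2_inner_cong[of f T f f' f'] by simp

lemma L2_mult_integrable: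
  assumes "f \<in> L2_space T" "g \<in> L2_space T"
  shows "integrable (leb T) (\<lambda>t. f t * g t)"
proof (rule Bochner_Integration.integrable_bound)
  show "integrable (leb T) (\<lambda>t. (f t)\<^sup>2 + (g t)\<^sup>2)"
    using assms by (auto simp: L2_space_def)
  show "(\<lambda>t. f t * g t) \<in> borel_measurable (leb T)"
    using assms by (auto simp: L2_space_def)
  have "\<bar>x * y\<bar> \<le> x\<^sup>2 + y\<^sup>2" for x y :: real
  proof -
    have "2 * (\<bar>x\<bar> * \<bar>y\<bar>) \<le> x\<^sup>2 + y\<^sup>2"
      using sum_squares_bound[of "\<bar>x\<bar>" "\<bar>y\<bar>"] by (simp add: mult.assoc)
    then show ?thesis
      using mult_nonneg_nonneg[of "\<bar>x\<bar>" "\<bar>y\<bar>"] unfolding abs_mult by linarith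
  qed
  then show "AE t in leb T. norm (f t * g t) \<le> norm ((f t)\<^sup>2 + (g t)\<^sup>2)"
    by (intro AE_I2) (metis abs_ge_self order_trans real_norm_def)
qed

lemma continuous_on_L2: 
  assumes "continuous_on {0..T} f"
  shows "f \<in> L2_space T"
proof -
  have "f \<in> borel_measurable (leb T)"
    by (intro continuous_imp_measurable_on_sets_lebesgue continuous_on_subset[OF assms]) auto
  moreover have "integrable (leb T) (\<lambda>t. (f t)\<^sup>2)"
    unfolding integrable_leb_iff
    by (intro absolutely_integrable_continuous_real continuous_intros assms)
  ultimately show ?thesis
    by (simp add: L2_space_def)
qed

lemma L2_add: "f \<in> L2_space T \<Longrightarrow> g \<in> L2_space T \<Longrightarrow> (\<lambda>t. a * f t + b * g t) \<in> L2_space T"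
  unfolding L2_space_def
proof safe
  assume a: "f \<in> borel_measurable (leb T)" "g \<in> borel_measurable (leb T)"
    "integrable (leb T) (\<lambda>t. (f t)\<^sup>2)" "integrable (leb T) (\<lambda>t. (g t)\<^sup>2)"
  then show "(\<lambda>t. a * f t + b * g t) \<in> borel_measurable (leb T)"
    by simp
  have "integrable (leb T) (\<lambda>t. f t * g t)"
    by (rule L2_mult_integrable) (use a in \<open>auto simp: L2_space_def\<close>)
  then have "integrable (leb T) (\<lambda>t. a\<^sup>2 * (f t)\<^sup>2 + 2 * a * b * (f t * g t) + b\<^sup>2 * (g t)\<^sup>2)"
    using a by simp
  then show "integrable (leb T) (\<lambda>t. (a * f t + b * g t)\<^sup>2)"
    by (rule Bochner_Integration.integrable_cong[THEN iffD1, rotated 2]) (simp_all add: power2_eq_square algebra_simps)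
qed

lemma L2_diff: "f \<in> L2_space T \<Longrightarrow> g \<in> L2_space T \<Longrightarrow> (\<lambda>t. f t - g t) \<in> L2_space T"
  and L2_cmult: "f \<in> L2_space T \<Longrightarrow> (\<lambda>t. a * f t) \<in> L2_space T"
  using L2_add[of f T g 1 "-1"] L2_add[of f T f a 0] by simp_all

lemma L2_mult_bounded:
  assumes "continuous_on {0..T} g" "f \<in> L2_space T"
  shows "(\<lambda>t. g t * f t) \<in> L2_space T"
proof -
  have g: "g \<in> borel_measurable (leb T)"
    using continuous_on_L2[OF assms(1)] by (simp add: L2_space_def)
  have "(\<lambda>t. (g t)\<^sup>2 * (f t)\<^sup>2) absolutely_integrable_on {0..T}"
    using assms by (intro absolutely_integrable_bounded_measurable_product_real compact_imp_bounded
        compact_continuous_image continuous_imp_measurable_on_sets_lebesgue continuous_intros)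
      (auto simp: L2_space_def integrable_leb_iff)
  then show ?thesis
    using g L2_spaceD(1)[OF assms(2)]
    by (simp add: L2_space_def integrable_leb_iff power_mult_distrib)
qed

lemma L2_mult_bounded_right:
  "continuous_on {0..T} g \<Longrightarrow> f \<in> L2_space T \<Longrightarrow> (\<lambda>t. f t * g t) \<in> L2_space T"
  using L2_mult_bounded[of T g f] by (simp add: mult.commute)

lemma L2_inner_commute: "L2_inner T f g = L2_inner T g f"
  by (simp add: L2_inner_def mult.commute)

lemma L2_inner_add_left:
  assumes "f \<in> L2_space T" "g \<in> L2_space T" "h \<in> L2_space T"
  shows "L2_inner T (\<lambda>t. a * f t + b * g t) h = a * L2_inner T f h + b * L2_inner T g h"
proof -
  have "L2_inner T (\<lambda>t. a * f t + b * g t) h = (LINT t|leb T. a * (f t * h t) + b * (g t * h t))"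
    by (simp add: L2_inner_def algebra_simps)
  then show ?thesis
    using assms by (simp add: L2_inner_def L2_mult_integrable)
qed

lemma L2_inner_diff_left:
  "f \<in> L2_space T \<Longrightarrow> g \<in> L2_space T \<Longrightarrow> h \<in> L2_space T \<Longrightarrow>
    L2_inner T (\<lambda>t. f t - g t) h = L2_inner T f h - L2_inner T g h"
  using L2_inner_add_left[of f T g h 1 "-1"] by simp

lemma L2_inner_diff_right:
  "f \<in> L2_space T \<Longrightarrow> g \<in> L2_space T \<Longrightarrow> h \<in> L2_space T \<Longrightarrow>
    L2_inner T h (\<lambda>t. f t - g t) = L2_inner T h f - L2_inner T h g"
  using L2_inner_diff_left by (simp add: L2_inner_commute)

lemma L2_inner_cmult: "L2_inner T (\<lambda>t. c * f t) g = c * L2_inner T f g"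
  by (simp add: L2_inner_def mult.assoc)

lemma L2_inner_cmult_right: "L2_inner T f (\<lambda>t. c * g t) = c * L2_inner T f g"
  using L2_inner_cmult[of T c g f] by (simp only: L2_inner_commute)

lemma L2_inner_self_nonneg: "0 \<le> L2_inner T f f"
  by (simp add: L2_inner_def)

lemma L2_norm_nonneg: "0 \<le> L2_norm T f"
  by (simp add: L2_norm_def L2_inner_self_nonneg)

lemma L2_norm_power2: "(L2_norm T f)\<^sup>2 = L2_inner T f f"
  by (simp add: L2_norm_def L2_inner_self_nonneg)

lemma L2_Cauchy_Schwarz:
  assumes "f \<in> L2_space T" "g \<in> L2_space T"
  shows "\<bar>L2_inner T f g\<bar> \<le> L2_norm T f * L2_norm T g"
proof -
  let ?a = "L2_inner T f f" and ?b = "L2_inner T f g" and ?c = "L2_inner T g g"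
  have q: "0 \<le> x\<^sup>2 * ?a + 2 * x * y * ?b + y\<^sup>2 * ?c" for x y
  proof -
    have "L2_inner T (\<lambda>t. x * f t + y * g t) (\<lambda>t. x * f t + y * g t) =
        x * L2_inner T (\<lambda>t. x * f t + y * g t) f + y * L2_inner T (\<lambda>t. x * f t + y * g t) g"
      using assms L2_inner_add_left[of f T g "\<lambda>t. x * f t + y * g t" x y]
      by (simp add: L2_add L2_inner_commute)
    also have "\<dots> = x\<^sup>2 * ?a + 2 * x * y * ?b + y\<^sup>2 * ?c"
      using assms by (simp add: L2_inner_add_left L2_inner_commute[of T g f] power2_eq_square algebra_simps)
    finally show ?thesis
      using L2_inner_self_nonneg by metis
  qed
  have "?b\<^sup>2 \<le> ?a * ?c"
  proof (cases "?a = 0")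
    case True
    have "?b = 0"
    proof (rule ccontr)
      assume "?b \<noteq> 0"
      \<comment> \<open>For ?a = 0 the quadratic form is affine in x when y = 1, and this x gives it
        the value -1.\<close>
      then show False
        using q[of "- (?c + 1) / (2 * ?b)" 1] True by (simp add: field_simps)
    qed
    then show ?thesis
      using True by simp
  next
    case False
    then have "0 < ?a"
      using L2_inner_self_nonneg[of T f] by simp
    moreover have "0 \<le> ?a * (?a * ?c - ?b\<^sup>2)"
      using q[of "- ?b" "?a"] by (simp add: power2_eq_square algebra_simps)
    ultimately show ?thesis
      by (simp add: zero_le_mult_iff)
  qed
  then have "sqrt (?b\<^sup>2) \<le> sqrt (?a * ?c)"
    by (rule real_sqrt_le_mono)
  then show ?thesis
    by (simp add: L2_norm_def real_sqrt_mult)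
qed

lemma L2_norm_triangle:
  assumes "f \<in> L2_space T" "g \<in> L2_space T"
  shows "L2_norm T (\<lambda>t. f t + g t) \<le> L2_norm T f + L2_norm T g"
proof -
  have "(L2_norm T (\<lambda>t. f t + g t))\<^sup>2 = L2_inner T (\<lambda>t. 1 * f t + 1 * g t) (\<lambda>t. 1 * f t + 1 * g t)"
    by (simp add: L2_norm_power2)
  also have "\<dots> = L2_inner T (\<lambda>t. 1 * f t + 1 * g t) f + L2_inner T (\<lambda>t. 1 * f t + 1 * g t) g"
    using assms L2_inner_add_left[of f T g "\<lambda>t. 1 * f t + 1 * g t" 1 1] L2_add[of f T g 1 1]
    by (simp add: L2_inner_commute)
  also have "\<dots> = L2_inner T f f + 2 * L2_inner T f g + L2_inner T g g"
    using assms L2_inner_add_left[of f T g _ 1 1] by (simp add: L2_inner_commute[of T g f])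
  also have "\<dots> \<le> (L2_norm T f + L2_norm T g)\<^sup>2"
    using L2_Cauchy_Schwarz[OF assms] by (simp add: power2_sum L2_norm_power2)
  finally show ?thesis
    by (rule power2_le_imp_le) (simp add: L2_norm_nonneg)
qed

lemma L2_norm_minus_commute: "L2_norm T (\<lambda>t. f t - g t) = L2_norm T (\<lambda>t. g t - f t)"
  by (simp add: L2_norm_def L2_inner_def algebra_simps)

lemma L2_norm_triangle_diff:
  assumes "f \<in> L2_space T" "g \<in> L2_space T" "h \<in> L2_space T"
  shows "L2_norm T (\<lambda>t. f t - h t) \<le> L2_norm T (\<lambda>t. f t - g t) + L2_norm T (\<lambda>t. g t - h t)"
  using L2_norm_triangle[OF L2_diff[OF assms(1,2)] L2_diff[OF assms(2,3)]] by simp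

lemma L2_norm_cmult: "L2_norm T (\<lambda>t. c * f t) = \<bar>c\<bar> * L2_norm T f"
proof -
  have "L2_inner T (\<lambda>t. c * f t) (\<lambda>t. c * f t) = c\<^sup>2 * L2_inner T f f"
    by (simp add: L2_inner_def power2_eq_square algebra_simps flip: integral_mult_right_zero)
  then show ?thesis
    by (simp add: L2_norm_def real_sqrt_mult)
qed

lemma L2_norm_le_pointwise:
  assumes "f \<in> L2_space T" "g \<in> L2_space T" "\<And>t. 0 < t \<Longrightarrow> t < T \<Longrightarrow> \<bar>f t\<bar> \<le> \<bar>g t\<bar>"
  shows "L2_norm T f \<le> L2_norm T g"
  unfolding L2_norm_def L2_inner_def
  using assms by (intro real_sqrt_le_mono integral_mono L2_mult_integrable)
    (auto simp: abs_le_square_iff power2_eq_square[symmetric])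

lemma L2_const: "(\<lambda>_. c) \<in> L2_space T"
  by (rule continuous_on_L2) simp

lemma L2_norm_const:
  assumes "0 < T"
  shows "L2_norm T (\<lambda>_. c) = \<bar>c\<bar> * sqrt T"
proof -
  have "(LINT t|leb T. c * c) = T * c\<^sup>2"
    using LINT_leb[OF L2_mult_integrable[OF L2_const L2_const], of T c c] assms
    by (simp only:) (simp add: power2_eq_square)
  then show ?thesis
    by (simp add: L2_norm_def L2_inner_def real_sqrt_mult del: lebesgue_integral_const)
qed

lemma L2_integrable: "f \<in> L2_space T \<Longrightarrow> integrable (leb T) f"
  using L2_mult_integrable[OF _ L2_const[of 1]] by simp

section \<open>Primitives and integration by parts\<close>

text \<open>The two summands integrate f(x) g(y) over the triangles on either side of the diagonal;
  Fubini exchanges the order in one of them.\<close>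

lemma lborel_integral_by_parts:
  fixes f g :: "real \<Rightarrow> real"
  assumes f: "integrable lborel f" and g: "integrable lborel g"
  shows "(LINT x|lborel. f x * (LINT y|lborel. indicator {..x} y * g y)) +
    (LINT y|lborel. g y * (LINT x|lborel. indicator {..y} x * f x)) = (LINT x|lborel. f x) * (LINT y|lborel. g y)"
proof -
  note [measurable] = borel_measurable_integrable[OF f] borel_measurable_integrable[OF g]
  let ?h = "\<lambda>x y. if y \<le> x then f x * g y else 0"
  have "integrable (lborel \<Otimes>\<^sub>M lborel) (\<lambda>(x, y). f x * g y)"
    using f g by (intro lborel_pair.Fubini_integrable) (auto simp: abs_mult)
  then have h: "integrable (lborel \<Otimes>\<^sub>M lborel) (\<lambda>(x, y). ?h x y)"
    by (rule Bochner_Integration.integrable_bound) (auto simp: case_prod_beta)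
  have "(LINT x|lborel. f x * (LINT y|lborel. indicator {..x} y * g y)) = (LINT x|lborel. LINT y|lborel. ?h x y)"
    by (intro Bochner_Integration.integral_cong refl)
      (auto simp flip: integral_mult_right_zero intro!: Bochner_Integration.integral_cong simp: indicator_def)
  also have "\<dots> = (LINT y|lborel. LINT x|lborel. ?h x y)"
    using lborel_pair.Fubini_integral[OF h] by simp
  also have "\<dots> = (LINT y|lborel. g y * ((LINT x|lborel. f x) - (LINT x|lborel. indicator {..y} x * f x)))"
  proof (intro Bochner_Integration.integral_cong refl)
    fix y
    have i: "integrable lborel (\<lambda>x. indicator {..y} x * f x)"
      using integrable_mult_indicator[OF _ f, of "{..y}"] by simp
    \<comment> \<open>For fixed y the two integrands differ at most at x = y.\<close>
    have "(LINT x|lborel. ?h x y) = (LINT x|lborel. g y * (f x - indicator {..y} x * f x))"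
      using AE_lborel_singleton[of y]
      by (intro integral_cong_AE) (auto elim!: eventually_mono simp: indicator_def)
    also have "\<dots> = g y * ((LINT x|lborel. f x) - (LINT x|lborel. indicator {..y} x * f x))"
      using f i by simp
    finally show "(LINT x|lborel. ?h x y) = \<dots>" .
  qed
  also have "\<dots> = (LINT x|lborel. f x) * (LINT y|lborel. g y) - (LINT y|lborel. g y * (LINT x|lborel. indicator {..y} x * f x))"
  proof -
    have "integrable lborel (\<lambda>y. g y * (LINT x|lborel. indicator {..y} x * f x))"
    proof (rule Bochner_Integration.integrable_bound)
      show "integrable lborel (\<lambda>y. g y * (LINT x|lborel. \<bar>f x\<bar>))"
        using g by simp
      have [measurable]: "(\<lambda>y. LINT x|lborel. indicator {..y} x * f x) \<in> borel_measurable borel"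
      proof -
        have "(\<lambda>y. LINT x|lborel. (if x \<le> y then f x else 0)) \<in> borel_measurable borel"
          by measurable
        then show ?thesis
          by (simp add: indicator_def if_distrib cong: if_cong)
      qed
      show "(\<lambda>y. g y * (LINT x|lborel. indicator {..y} x * f x)) \<in> borel_measurable lborel"
        by measurable
      have "\<bar>LINT x|lborel. indicator {..y} x * f x\<bar> \<le> (LINT x|lborel. \<bar>f x\<bar>)" for y
        using Bochner_Integration.integral_norm_bound_integral[of lborel "\<lambda>x. indicator {..y} x * f x" "\<lambda>x. \<bar>f x\<bar>"]
          f integrable_mult_indicator[OF _ f, of "{..y}"] by (auto simp: indicator_def)
      then show "AE y in lborel. norm (g y * (LINT x|lborel. indicator {..y} x * f x)) \<le> norm (g y * (LINT x|lborel. \<bar>f x\<bar>))"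
        unfolding real_norm_def abs_mult by (intro AE_I2 mult_left_mono) (auto intro: order_trans[OF _ abs_ge_self])
    qed
    then show ?thesis
      using g by (simp add: right_diff_distrib)
  qed
  finally show ?thesis
    by simp
qed

lemma LINT_lborel_eq_integral:
  fixes k K :: "real \<Rightarrow> real"
  assumes "k \<in> borel_measurable borel" "K absolutely_integrable_on {a..b}"
    and "AE x in lborel. k x = indicator {a..b} x * K x"
  shows "(LINT x|lborel. k x) = integral {a..b} K"
proof -
  have K: "integrable lebesgue (\<lambda>x. indicator {a..b} x * K x)"
    using assms(2) by (simp add: set_integrable_def)
  have "(LINT x|lborel. k x) = (LINT x|lebesgue. k x)"
    using assms(1) by (simp add: integral_completion)
  also have "\<dots> = (LINT x|lebesgue. indicator {a..b} x * K x)"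
  proof (rule integral_cong_AE)
    show "k \<in> borel_measurable lebesgue"
      using assms(1) by (simp add: measurable_completion)
    show "AE x in lebesgue. k x = indicator {a..b} x * K x"
      by (rule AE_completion[OF assms(3)])
  qed (rule borel_measurable_integrable[OF K])
  also have "\<dots> = integral {a..b} K"
    using set_lebesgue_integral_eq_integral(2)[OF assms(2)] by (simp add: set_lebesgue_integral_def)
  finally show ?thesis .
qed

text \<open>Fubini is applied over \<open>lborel\<close>, so a Lebesgue integrable function is first
  replaced by a Borel one that agrees with it off a null set.\<close>

lemma borel_version:
  fixes f :: "real \<Rightarrow> real"
  assumes "f absolutely_integrable_on {a..b}"
  obtains f' where "integrable lborel f'" "AE x in lborel. f' x = indicator {a..b} x * f x"
proof -
  have i: "integrable lebesgue (\<lambda>x. indicator {a..b} x * f x)"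
    using assms by (simp add: set_integrable_def)
  then obtain f' where f': "f' \<in> borel_measurable lborel" "AE x in lborel. indicator {a..b} x * f x = f' x"
    using completion_ex_borel_measurable_real[OF borel_measurable_integrable[OF i]] by blast
  have "integrable lebesgue f'"
    using f' by (intro integrable_cong_AE_imp[OF i] measurable_completion AE_completion) auto
  then have "integrable lborel f'"
    using f'(1) integrable_completion by blast
  moreover have "AE x in lborel. f' x = indicator {a..b} x * f x"
    using f'(2) by eventually_elim simp
  ultimately show ?thesis
    by (rule that)
qed

lemma absolutely_integrable_subinterval:
  fixes f :: "real \<Rightarrow> real"
  shows "f absolutely_integrable_on {a..b} \<Longrightarrow> a \<le> c \<Longrightarrow> d \<le> b \<Longrightarrow> f absolutely_integrable_on {c..d}"
  by (rule absolutely_integrable_on_subinterval) auto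

lemma absolutely_integrable_mult_continuous:
  fixes f g :: "real \<Rightarrow> real"
  assumes "f absolutely_integrable_on {a..b}" "continuous_on {a..b} g"
  shows "(\<lambda>t. f t * g t) absolutely_integrable_on {a..b}"
proof -
  have "(\<lambda>t. g t * f t) absolutely_integrable_on {a..b}"
    using assms by (intro absolutely_integrable_bounded_measurable_product_real
        continuous_imp_measurable_on_sets_lebesgue compact_imp_bounded compact_continuous_image) auto
  then show ?thesis
    by (simp add: mult.commute)
qed

lemma indefinite_integral_continuous_on:
  fixes f :: "real \<Rightarrow> real"
  shows "f absolutely_integrable_on {a..b} \<Longrightarrow> continuous_on {a..b} (\<lambda>t. integral {a..t} f)"
  by (intro indefinite_integral_continuous_1 set_lebesgue_integral_eq_integral(1))

lemma integral_by_parts_indefinite: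
  fixes f g :: "real \<Rightarrow> real"
  assumes f: "f absolutely_integrable_on {0..T}" and g: "g absolutely_integrable_on {0..T}" and "0 \<le> T"
  shows "integral {0..T} (\<lambda>t. f t * integral {0..t} g) + integral {0..T} (\<lambda>t. g t * integral {0..t} f) =
    integral {0..T} f * integral {0..T} g"
proof -
  obtain f' where f': "integrable lborel f'" "AE x in lborel. f' x = indicator {0..T} x * f x"
    using borel_version[OF f] .
  obtain g' where g': "integrable lborel g'" "AE x in lborel. g' x = indicator {0..T} x * g x"
    using borel_version[OF g] .
  have part: "(LINT x|lborel. indicator {..y} x * h' x) = integral {0..y} h"
    if "integrable lborel h'" "AE x in lborel. h' x = indicator {0..T} x * h x"
      "h absolutely_integrable_on {0..T}" "0 \<le> y" "y \<le> T" for h h' :: "real \<Rightarrow> real" and y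
  proof (rule LINT_lborel_eq_integral)
    show "(\<lambda>x. indicator {..y} x * h' x) \<in> borel_measurable borel"
      using borel_measurable_integrable[OF that(1)] by simp
    show "h absolutely_integrable_on {0..y}"
      using absolutely_integrable_subinterval[OF that(3)] that by simp
    show "AE x in lborel. indicator {..y} x * h' x = indicator {0..y} x * h x"
      using that(2) by eventually_elim (use that in \<open>auto simp: indicator_def\<close>)
  qed
  have meas: "(\<lambda>y. LINT x|lborel. indicator {..y} x * h' x) \<in> borel_measurable borel"
    if "integrable lborel h'" for h' :: "real \<Rightarrow> real"
  proof -
    note [measurable] = borel_measurable_integrable[OF that]
    have "(\<lambda>y. LINT x|lborel. (if x \<le> y then h' x else 0)) \<in> borel_measurable borel"
      by measurable
    then show ?thesis
      by (simp add: indicator_def if_distrib cong: if_cong)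
  qed
  \<comment> \<open>Stated for a general pair, because the two iterated integrals are its instances
    with f and g exchanged.\<close>
  have mixed: "(LINT x|lborel. k' x * (LINT y|lborel. indicator {..x} y * h' y)) = integral {0..T} (\<lambda>t. k t * integral {0..t} h)"
    if h: "integrable lborel h'" "AE x in lborel. h' x = indicator {0..T} x * h x" "h absolutely_integrable_on {0..T}"
      and k: "integrable lborel k'" "AE x in lborel. k' x = indicator {0..T} x * k x" "k absolutely_integrable_on {0..T}"
    for h h' k k' :: "real \<Rightarrow> real"
  proof (rule LINT_lborel_eq_integral)
    show "(\<lambda>x. k' x * (LINT y|lborel. indicator {..x} y * h' y)) \<in> borel_measurable borel"
      using borel_measurable_integrable[OF k(1)] meas[OF h(1)] by simp
    show "(\<lambda>t. k t * integral {0..t} h) absolutely_integrable_on {0..T}"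
      by (intro absolutely_integrable_mult_continuous indefinite_integral_continuous_on k h)
    show "AE x in lborel. k' x * (LINT y|lborel. indicator {..x} y * h' y) = indicator {0..T} x * (k x * integral {0..x} h)"
      using k(2)
    proof eventually_elim
      case (elim x)
      then show ?case
        using part[OF h, of x] by (cases "0 \<le> x \<and> x \<le> T") auto
    qed
  qed
  have total: "(LINT x|lborel. h' x) = integral {0..T} h"
    if "integrable lborel h'" "AE x in lborel. h' x = indicator {0..T} x * h x" "h absolutely_integrable_on {0..T}"
    for h h' :: "real \<Rightarrow> real"
    using borel_measurable_integrable[OF that(1)] that by (intro LINT_lborel_eq_integral) auto
  show ?thesis
    using lborel_integral_by_parts[OF f'(1) g'(1)]
    unfolding mixed[OF g' g f' f] mixed[OF f' f g' g] total[OF f' f] total[OF g' g] .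
qed

text \<open>F is the absolutely continuous representative of an H^1 function and f its derivative.
  Keeping the pair avoids pointwise derivatives, and values of F outside [0,T] remain free.\<close>

definition primitive :: "real \<Rightarrow> (real \<Rightarrow> real) \<Rightarrow> (real \<Rightarrow> real) \<Rightarrow> bool" where
  "primitive T F f \<longleftrightarrow> f \<in> L2_space T \<and> (\<forall>t\<in>{0..T}. integral {0..t} f = F t - F 0)"

lemma primitiveD:
  assumes "primitive T F f"
  shows "f \<in> L2_space T" "\<And>t. 0 \<le> t \<Longrightarrow> t \<le> T \<Longrightarrow> F t = F 0 + integral {0..t} f"
  using assms by (simp_all add: primitive_def)

lemma primitive_absolutely_integrable: "primitive T F f \<Longrightarrow> f absolutely_integrable_on {0..T}"
  unfolding integrable_leb_iff[symmetric] by (intro L2_integrable primitiveD(1))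

lemma primitive_continuous:
  assumes "primitive T F f"
  shows "continuous_on {0..T} F"
proof -
  have "continuous_on {0..T} (\<lambda>t. F 0 + integral {0..t} f)"
    by (intro continuous_intros indefinite_integral_continuous_on primitive_absolutely_integrable[OF assms])
  then show ?thesis
    by (rule continuous_on_eq) (use assms in \<open>simp add: primitive_def\<close>)
qed

lemma primitive_L2: "primitive T F f \<Longrightarrow> F \<in> L2_space T"
  by (intro continuous_on_L2 primitive_continuous)

lemma primitive_transform:
  "primitive T F f \<Longrightarrow> (\<And>t. F t = G t) \<Longrightarrow> (\<And>t. f t = g t) \<Longrightarrow> primitive T G g"
  by (metis ext)

lemma primitive_integral:
  "f \<in> L2_space T \<Longrightarrow> primitive T (\<lambda>t. c + integral {0..t} f) f"
  by (simp add: primitive_def)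

lemma primitive_add:
  assumes "primitive T F f" "primitive T G g"
  shows "primitive T (\<lambda>t. a * F t + b * G t) (\<lambda>t. a * f t + b * g t)"
proof -
  have "integral {0..t} (\<lambda>t. a * f t + b * g t) = a * integral {0..t} f + b * integral {0..t} g" if "t \<le> T" for t
  proof -
    have "f integrable_on {0..t}" "g integrable_on {0..t}"
      by (rule set_lebesgue_integral_eq_integral(1),
          rule absolutely_integrable_subinterval[OF primitive_absolutely_integrable],
          rule assms, use that in simp_all)+
    then show ?thesis
      by (simp add: Henstock_Kurzweil_Integration.integral_add integrable_on_mult_right)
  qed
  then show ?thesis
    using assms by (simp add: primitive_def L2_add right_diff_distrib)
qed

lemma primitive_diff:
  "primitive T F f \<Longrightarrow> primitive T G g \<Longrightarrow> primitive T (\<lambda>t. F t - G t) (\<lambda>t. f t - g t)"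
  using primitive_add[of T F f G g 1 "-1"] by simp

lemma primitive_C1:
  assumes "\<And>t. 0 \<le> t \<Longrightarrow> t \<le> T \<Longrightarrow> (F has_real_derivative f t) (at t)" "continuous_on {0..T} f"
  shows "primitive T F f"
proof -
  have "integral {0..t} f = F t - F 0" if t: "0 \<le> t" "t \<le> T" for t
  proof -
    have "(f has_integral F t - F 0) {0..t}"
      using t assms(1) by (intro fundamental_theorem_of_calculus)
        (auto simp flip: has_real_derivative_iff_has_vector_derivative intro: has_field_derivative_at_within)
    then show ?thesis
      by (simp add: integral_unique)
  qed
  with assms(2) show ?thesis
    by (auto simp: primitive_def continuous_on_L2)
qed

lemma primitive_const: "primitive T (\<lambda>_. c) (\<lambda>_. 0)"
  by (rule primitive_C1) auto

lemma integral_by_parts_primitive: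
  assumes F: "primitive T F f" and G: "primitive T G g" and "0 \<le> T"
  shows "L2_inner T f G + L2_inner T F g = F T * G T - F 0 * G 0"
proof -
  note f = primitive_absolutely_integrable[OF F] and g = primitive_absolutely_integrable[OF G]
  note fi = set_lebesgue_integral_eq_integral(1)[OF f] and gi = set_lebesgue_integral_eq_integral(1)[OF g]
  have fG: "L2_inner T f G = G 0 * integral {0..T} f + integral {0..T} (\<lambda>t. f t * integral {0..t} g)"
  proof -
    have "L2_inner T f G = integral {0..T} (\<lambda>t. f t * G t)"
      unfolding L2_inner_def by (rule LINT_leb[OF L2_mult_integrable[OF primitiveD(1)[OF F] primitive_L2[OF G]]])
    also have "\<dots> = integral {0..T} (\<lambda>t. G 0 * f t + f t * integral {0..t} g)"
    proof (rule integral_cong)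
      fix t assume "t \<in> {0..T}"
      then show "f t * G t = G 0 * f t + f t * integral {0..t} g"
        using primitiveD(2)[OF G, of t] by (simp add: algebra_simps)
    qed
    also have "\<dots> = G 0 * integral {0..T} f + integral {0..T} (\<lambda>t. f t * integral {0..t} g)"
      using fi set_lebesgue_integral_eq_integral(1)[OF absolutely_integrable_mult_continuous[OF f indefinite_integral_continuous_on[OF g]]]
      by (subst Henstock_Kurzweil_Integration.integral_add) (auto intro: integrable_on_mult_right)
    finally show ?thesis .
  qed
  have Fg: "L2_inner T F g = F 0 * integral {0..T} g + integral {0..T} (\<lambda>t. g t * integral {0..t} f)"
  proof -
    have "L2_inner T F g = integral {0..T} (\<lambda>t. F t * g t)"
      unfolding L2_inner_def by (rule LINT_leb[OF L2_mult_integrable[OF primitive_L2[OF F] primitiveD(1)[OF G]]])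
    also have "\<dots> = integral {0..T} (\<lambda>t. F 0 * g t + g t * integral {0..t} f)"
    proof (rule integral_cong)
      fix t assume "t \<in> {0..T}"
      then show "F t * g t = F 0 * g t + g t * integral {0..t} f"
        using primitiveD(2)[OF F, of t] by (simp add: algebra_simps)
    qed
    also have "\<dots> = F 0 * integral {0..T} g + integral {0..T} (\<lambda>t. g t * integral {0..t} f)"
      using gi set_lebesgue_integral_eq_integral(1)[OF absolutely_integrable_mult_continuous[OF g indefinite_integral_continuous_on[OF f]]]
      by (subst Henstock_Kurzweil_Integration.integral_add) (auto intro: integrable_on_mult_right)
    finally show ?thesis .
  qed
  show ?thesis
    using integral_by_parts_indefinite[OF f g \<open>0 \<le> T\<close>] primitiveD(2)[OF F, of T] primitiveD(2)[OF G, of T] \<open>0 \<le> T\<close>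
    unfolding fG Fg by (simp add: algebra_simps)
qed

lemma L2_space_mono:
  assumes "f \<in> L2_space T" "t \<le> T"
  shows "f \<in> L2_space t"
proof -
  have "f \<in> borel_measurable (leb t)"
    using L2_spaceD(1)[OF assms(1)] by (rule measurable_restrict_mono) (use assms(2) in auto)
  moreover have "integrable (leb t) (\<lambda>t. (f t)\<^sup>2)"
    using absolutely_integrable_subinterval[where f="\<lambda>t. (f t)\<^sup>2" and a=0 and b=T and c=0 and d=t] assms(2) L2_spaceD(2)[OF assms(1)]
    by (simp add: integrable_leb_iff power2_eq_square)
  ultimately show ?thesis
    by (simp add: L2_space_def)
qed

lemma primitive_mono: "primitive T F f \<Longrightarrow> t \<le> T \<Longrightarrow> primitive t F f"
  by (auto simp: primitive_def intro: L2_space_mono)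

text \<open>The product rule is integration by parts on every [0,t], to which the pairs restrict by
  \<open>primitive_mono\<close>.\<close>

lemma primitive_mult:
  assumes F: "primitive T F f" and G: "primitive T G g"
  shows "primitive T (\<lambda>t. F t * G t) (\<lambda>t. f t * G t + F t * g t)"
proof -
  have L2: "(\<lambda>t. f t * G t) \<in> L2_space T" "(\<lambda>t. F t * g t) \<in> L2_space T"
    using F G by (auto intro: L2_mult_bounded L2_mult_bounded_right primitive_continuous primitiveD(1))
  have "integral {0..t} (\<lambda>t. f t * G t + F t * g t) = F t * G t - F 0 * G 0" if t: "0 \<le> t" "t \<le> T" for t
  proof -
    have i: "integrable (leb t) (\<lambda>t. f t * G t)" "integrable (leb t) (\<lambda>t. F t * g t)"
      using L2 t by (auto intro: L2_integrable L2_space_mono)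
    have "L2_inner t f G + L2_inner t F g = F t * G t - F 0 * G 0"
      by (rule integral_by_parts_primitive) (use F G t in \<open>auto intro: primitive_mono\<close>)
    moreover have "L2_inner t f G + L2_inner t F g = (LINT s|leb t. f s * G s + F s * g s)"
      using i by (simp add: L2_inner_def)
    moreover have "\<dots> = integral {0..t} (\<lambda>t. f t * G t + F t * g t)"
      using i by (intro LINT_leb) simp
    ultimately show ?thesis
      by simp
  qed
  moreover have "(\<lambda>t. f t * G t + F t * g t) \<in> L2_space T"
    using L2_add[OF L2, of 1 1] by simp
  ultimately show ?thesis
    by (simp add: primitive_def)
qed

lemma primitive_test_function:
  assumes "\<phi> \<in> test_functions T" "0 < T"
  shows "primitive T \<phi> (deriv \<phi>)"
proof -
  have "smooth \<phi>"
    using test_functionsE[OF assms] by metis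
  then show ?thesis
    by (intro primitive_C1 smooth_has_deriv smooth_continuous_on smooth_deriv)
qed

lemma test_functions_boundary:
  assumes "\<phi> \<in> test_functions T" "0 < T"
  shows "\<phi> 0 = 0" "\<phi> T = 0"
  using test_functionsE[OF assms] by (metis atLeastAtMost_iff not_le)+

lemma L2_locally_integrable: "f \<in> L2_space T \<Longrightarrow> locally_integrable T f"
  using absolutely_integrable_subinterval[where f=f and a=0 and b=T] L2_integrable[of f T]
  by (auto simp: locally_integrable_def integrable_leb_iff)

lemma primitive_is_weak_deriv:
  assumes F: "primitive T F f" and "0 < T"
  shows "is_weak_deriv T 1 F f"
proof -
  have "L2_inner T F (deriv \<phi>) = - L2_inner T f \<phi>" if "\<phi> \<in> test_functions T" for \<phi>
    using integral_by_parts_primitive[OF F primitive_test_function[OF that \<open>0 < T\<close>]]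
      test_functions_boundary[OF that \<open>0 < T\<close>] \<open>0 < T\<close> by simp
  then show ?thesis
    using F by (auto simp: is_weak_deriv_def intro: L2_locally_integrable primitive_L2 primitiveD(1))
qed

text \<open>Subtracting the indefinite integral of v leaves a function with zero weak derivative,
  constant by \<open>du_Bois_Reymond\<close>.\<close>

lemma weak_deriv_imp_primitive:
  assumes "is_weak_deriv T 1 u v" "v \<in> L2_space T" "0 < T"
  obtains U where "primitive T U v" "ae_eq T u U"
proof -
  define V where "V t = integral {0..t} v" for t
  have V: "primitive T V v"
    using primitive_integral[OF assms(2), of 0] by (simp add: V_def[abs_def])
  have Vw: "is_weak_deriv T 1 V v"
    using V \<open>0 < T\<close> by (rule primitive_is_weak_deriv)
  obtain c where c: "AE t in leb T. u t + (- 1) * V t = c"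
  proof (rule du_Bois_Reymond[OF \<open>0 < T\<close>])
    show li: "locally_integrable T (\<lambda>t. u t + (- 1) * V t)"
      using assms(1) Vw by (intro locally_integrable_add) (auto simp: is_weak_deriv_def)
    show "L2_inner T (\<lambda>t. u t + (- 1) * V t) (deriv \<phi>) = 0" if "\<phi> \<in> test_functions T" for \<phi>
    proof (subst L2_inner_test_add)
      show "L2_inner T u (deriv \<phi>) + - 1 * L2_inner T V (deriv \<phi>) = 0"
        using assms(1) Vw that by (simp add: is_weak_deriv_def)
    qed (use assms Vw test_functions_deriv[OF that \<open>0 < T\<close>] in \<open>auto simp: is_weak_deriv_def\<close>)
  qed
  show ?thesis
  proof
    show "primitive T (\<lambda>t. c + V t) v"
      using primitive_integral[OF assms(2), of c] by (simp add: V_def)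
    show "ae_eq T u (\<lambda>t. c + V t)"
      using c unfolding ae_eq_def by eventually_elim simp
  qed
qed

section \<open>Representatives of functions in \<open>H\<^sup>2\<close>\<close>

text \<open>The difference has vanishing L^2 norm, and a continuous nonnegative function with zero
  integral vanishes on the closed interval. The endpoints, where traces are taken, are thereby
  covered; this makes \<open>trace_at\<close> well defined.\<close>

lemma continuous_ae_eq_imp_eq:
  assumes "0 < T" "continuous_on {0..T} f" "continuous_on {0..T} g" "ae_eq T f g" "0 \<le> x" "x \<le> T"
  shows "f x = g x"
proof -
  let ?d = "\<lambda>t. f t - g t"
  have c: "continuous_on {0..T} (\<lambda>t. ?d t * ?d t)"
    by (intro continuous_intros assms)
  have L: "?d \<in> L2_space T"
    by (intro L2_diff continuous_on_L2 assms)
  have "ae_eq T ?d (\<lambda>_. 0)"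
    using assms(4) unfolding ae_eq_def by eventually_elim simp
  then have "L2_inner T ?d ?d = L2_inner T (\<lambda>_. 0) (\<lambda>_. 0)"
    by (intro L2_inner_cong L)
  then have "integral {0..T} (\<lambda>t. ?d t * ?d t) = 0"
    using LINT_leb[OF L2_mult_integrable[OF L L]] by (simp add: L2_inner_def)
  then have "((\<lambda>t. ?d t * ?d t) has_integral 0) (cbox 0 T)"
    using integrable_integral[OF integrable_continuous_real[OF c]] by simp
  then have "?d x * ?d x = 0"
    by (rule has_integral_0_cbox_imp_0[rotated 2]) (use c assms in auto)
  then show ?thesis
    by simp
qed

lemma trace_at_eq:
  assumes "0 < T" "continuous_on {0..T} U" "ae_eq T u U" "0 \<le> x" "x \<le> T"
  shows "trace_at T u x = U x"
  unfolding trace_at_def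
proof (rule the_equality)
  show "\<exists>g. continuous_on {0..T} g \<and> ae_eq T u g \<and> U x = g x"
    using assms by blast
  fix y assume "\<exists>g. continuous_on {0..T} g \<and> ae_eq T u g \<and> y = g x"
  then obtain g where g: "continuous_on {0..T} g" "ae_eq T u g" "y = g x"
    by blast
  have "ae_eq T g U"
    by (rule ae_eq_trans[OF ae_eq_sym[OF g(2)] assms(3)])
  then show "y = U x"
    unfolding g(3) by (intro continuous_ae_eq_imp_eq[OF assms(1) g(1) assms(2) _ assms(4,5)])
qed

lemma test_functions_iterated_deriv:
  "\<phi> \<in> test_functions T \<Longrightarrow> 0 < T \<Longrightarrow> (deriv ^^ k) \<phi> \<in> test_functions T"
  by (induction k) (simp_all add: test_functions_deriv)

lemma test_functions_L2: "\<phi> \<in> test_functions T \<Longrightarrow> 0 < T \<Longrightarrow> \<phi> \<in> L2_space T"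
  using primitive_L2 primitive_test_function by metis

lemma is_weak_deriv_0: "f \<in> L2_space T \<Longrightarrow> is_weak_deriv T 0 f f"
  by (simp add: is_weak_deriv_def L2_locally_integrable)

lemma is_weak_deriv_cong:
  assumes "0 < T" "is_weak_deriv T k f g" "f \<in> L2_space T" "g \<in> L2_space T" "ae_eq T f f'" "ae_eq T g g'"
  shows "is_weak_deriv T k f' g'"
proof -
  have "L2_inner T f' ((deriv ^^ k) \<phi>) = (- 1) ^ k * L2_inner T g' \<phi>" if \<phi>: "\<phi> \<in> test_functions T" for \<phi>
  proof -
    have "L2_inner T f ((deriv ^^ k) \<phi>) = L2_inner T f' ((deriv ^^ k) \<phi>)"
      by (intro L2_inner_cong assms ae_eq_refl test_functions_L2 test_functions_iterated_deriv \<phi>)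
    moreover have "L2_inner T g \<phi> = L2_inner T g' \<phi>"
      by (intro L2_inner_cong assms ae_eq_refl test_functions_L2 \<phi>)
    ultimately show ?thesis
      using assms(2) \<phi> by (simp add: is_weak_deriv_def)
  qed
  moreover have "locally_integrable T f'" "locally_integrable T g'"
    by (intro L2_locally_integrable L2_space_cong[OF assms(3,5)] L2_space_cong[OF assms(4,6)])+
  ultimately show ?thesis
    by (simp add: is_weak_deriv_def)
qed

lemma is_weak_deriv_Suc:
  assumes "0 < T" "is_weak_deriv T 1 f g" "is_weak_deriv T k g h"
  shows "is_weak_deriv T (Suc k) f h"
proof -
  have "L2_inner T f ((deriv ^^ Suc k) \<phi>) = (- 1) ^ Suc k * L2_inner T h \<phi>" if \<phi>: "\<phi> \<in> test_functions T" for \<phi>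
  proof -
    have "(deriv ^^ k) \<phi> \<in> test_functions T"
      by (intro test_functions_iterated_deriv assms \<phi>)
    then have "L2_inner T f ((deriv ^^ 1) ((deriv ^^ k) \<phi>)) = (- 1) ^ 1 * L2_inner T g ((deriv ^^ k) \<phi>)"
      using assms(2) unfolding is_weak_deriv_def by blast
    moreover have "L2_inner T g ((deriv ^^ k) \<phi>) = (- 1) ^ k * L2_inner T h \<phi>"
      using assms(3) \<phi> unfolding is_weak_deriv_def by blast
    ultimately show ?thesis
      by simp
  qed
  then show ?thesis
    using assms unfolding is_weak_deriv_def by blast
qed

lemma sobolev_over_mono: "k \<le> m \<Longrightarrow> sobolev_over X T m \<subseteq> sobolev_over X T k"
  unfolding sobolev_over_def by auto

text \<open>
  \<open>U\<close>, \<open>V\<close>, \<open>g\<close> are the continuous representative of \<open>u\<close>, that of its derivative, and its second derivative.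
\<close>

definition H20_rep :: "real \<Rightarrow> (real \<Rightarrow> real) \<Rightarrow> (real \<Rightarrow> real) \<Rightarrow> (real \<Rightarrow> real) \<Rightarrow> (real \<Rightarrow> real) \<Rightarrow> bool" where
  "H20_rep T u U V g \<longleftrightarrow> primitive T U V \<and> primitive T V g \<and> U 0 = 0 \<and> ae_eq T u U"

lemma H20_repD:
  assumes "H20_rep T u U V g"
  shows "primitive T U V" "primitive T V g" "U 0 = 0" "ae_eq T u U"
    "U \<in> L2_space T" "V \<in> L2_space T" "g \<in> L2_space T" "u \<in> L2_space T"
proof -
  show *: "primitive T U V" "primitive T V g" "U 0 = 0" "ae_eq T u U"
    using assms by (simp_all add: H20_rep_def)
  show "U \<in> L2_space T" "V \<in> L2_space T" "g \<in> L2_space T"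
    by (rule primitive_L2[OF *(1)] primitiveD(1)[OF *(1)] primitiveD(1)[OF *(2)])+
  then show "u \<in> L2_space T"
    using L2_space_cong ae_eq_sym *(4) by blast
qed

lemma H20_rep_weak_deriv:
  assumes "H20_rep T u U V g" "0 < T"
  shows "is_weak_deriv T 0 u U" "is_weak_deriv T 1 u V" "is_weak_deriv T 2 u g"
proof -
  note r = H20_repD[OF assms(1)]
  note UV = primitive_is_weak_deriv[OF r(1) assms(2)] and Vg = primitive_is_weak_deriv[OF r(2) assms(2)]
  have Ug: "is_weak_deriv T 2 U g"
    using is_weak_deriv_Suc[OF assms(2) UV Vg] by (simp add: numeral_2_eq_2)
  note uU = ae_eq_sym[OF r(4)]
  show "is_weak_deriv T 0 u U" "is_weak_deriv T 1 u V" "is_weak_deriv T 2 u g"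
    by (rule is_weak_deriv_cong[OF assms(2) _ r(5) _ uU ae_eq_refl] is_weak_deriv_0 UV Ug r)+
qed

text \<open>Order 0 is included because even \<open>wderiv T 0 u\<close> is only some function
  almost everywhere equal to u.\<close>

lemma H20_rep_wderiv:
  assumes "H20_rep T u U V g" "0 < T"
  shows "ae_eq T (wderiv T 0 u) U" "ae_eq T (wderiv T 1 u) V" "ae_eq T (wderiv T 2 u) g"
  by (rule wderiv_ae_eq[OF assms(2)] H20_rep_weak_deriv[OF assms])+

lemma H20_rep_trace:
  assumes "H20_rep T u U V g" "0 < T" "0 \<le> x" "x \<le> T"
  shows "trace_at T u x = U x" "trace_at T (wderiv T 1 u) x = V x"
  by (rule trace_at_eq assms primitive_continuous[OF H20_repD(1)] primitive_continuous[OF H20_repD(2)]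
      H20_repD(4) H20_rep_wderiv(2))+

lemma H20_rep_imp_H20:
  assumes "H20_rep T u U V g" "0 < T"
  shows "u \<in> H20 T"
proof -
  note w = H20_rep_weak_deriv[OF assms] and r = H20_repD[OF assms(1)]
  have "\<exists>g\<in>L2_space T. is_weak_deriv T j u g" if "j \<le> 2" for j
  proof -
    from that have "j = 0 \<or> j = 1 \<or> j = 2"
      by auto
    with w r show ?thesis
      by blast
  qed
  moreover have "trace_at T u 0 = 0"
    using H20_rep_trace(1)[OF assms, of 0] r(3) assms(2) by simp
  ultimately show ?thesis
    using r(8) by (simp add: H20_def sobolev_over_def)
qed

text \<open>Testing with \<open>deriv \<phi>\<close> shows that the second weak derivative of u is
  the first weak derivative of v; then primitives are taken twice.\<close>

lemma H20_rep_exists: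
  assumes "u \<in> H20 T" "0 < T"
  obtains U V g where "H20_rep T u U V g"
proof -
  have u: "u \<in> L2_space T" and ex: "\<And>j. j \<le> 2 \<Longrightarrow> \<exists>g\<in>L2_space T. is_weak_deriv T j u g" and tr: "trace_at T u 0 = 0"
    using assms(1) by (simp_all add: H20_def sobolev_over_def)
  obtain v where v: "v \<in> L2_space T" "is_weak_deriv T 1 u v"
    using ex[of 1] by auto
  obtain g where g: "g \<in> L2_space T" "is_weak_deriv T 2 u g"
    using ex[of 2] by auto
  have "is_weak_deriv T 1 v g"
    unfolding is_weak_deriv_def
  proof (intro conjI ballI)
    fix \<phi> assume \<phi>: "\<phi> \<in> test_functions T"
    have "L2_inner T u ((deriv ^^ 1) (deriv \<phi>)) = (- 1) ^ 1 * L2_inner T v (deriv \<phi>)"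
      using v(2) test_functions_deriv[OF \<phi> assms(2)] unfolding is_weak_deriv_def by blast
    moreover have "L2_inner T u ((deriv ^^ 2) \<phi>) = (- 1) ^ 2 * L2_inner T g \<phi>"
      using g(2) \<phi> unfolding is_weak_deriv_def by blast
    ultimately show "L2_inner T v ((deriv ^^ 1) \<phi>) = (- 1) ^ 1 * L2_inner T g \<phi>"
      by (simp add: numeral_2_eq_2)
  qed (use v g L2_locally_integrable in auto)
  then obtain V where V: "primitive T V g" "ae_eq T v V"
    using weak_deriv_imp_primitive g(1) assms(2) by blast
  \<comment> \<open>Replacing v by its continuous representative lets the two primitives chain
    through the same V.\<close>
  have "is_weak_deriv T 1 u V"
    by (rule is_weak_deriv_cong[OF assms(2) v(2) u v(1) ae_eq_refl V(2)])
  then obtain U where U: "primitive T U V" "ae_eq T u U"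
    using weak_deriv_imp_primitive primitive_L2[OF V(1)] assms(2) by blast
  have "U 0 = 0"
    using trace_at_eq[OF assms(2) primitive_continuous[OF U(1)] U(2), of 0] tr assms(2) by simp
  with U V show ?thesis
    by (intro that) (simp add: H20_rep_def)
qed

lemma H20_rep_diff:
  "H20_rep T u U V g \<Longrightarrow> H20_rep T u' U' V' g' \<Longrightarrow>
    H20_rep T (\<lambda>t. u t - u' t) (\<lambda>t. U t - U' t) (\<lambda>t. V t - V' t) (\<lambda>t. g t - g' t)"
  by (simp add: H20_rep_def primitive_diff ae_eq_diff)

lemma H20_rep_norms:
  assumes "H20_rep T u U V g" "0 < T"
  shows "L2_norm T (wderiv T 0 u) = L2_norm T U" "L2_norm T (wderiv T 1 u) = L2_norm T V"
    "L2_norm T (wderiv T 2 u) = L2_norm T g"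
  by (rule L2_norm_cong[symmetric] H20_repD[OF assms(1)] ae_eq_sym[OF H20_rep_wderiv(1)[OF assms]]
      ae_eq_sym[OF H20_rep_wderiv(2)[OF assms]] ae_eq_sym[OF H20_rep_wderiv(3)[OF assms]])+

lemma H20_rep_diff_norms:
  assumes "H20_rep T u U V g" "H20_rep T u' U' V' g'" "0 < T"
  shows "L2_norm T (\<lambda>t. wderiv T 0 u t - wderiv T 0 u' t) = L2_norm T (\<lambda>t. U t - U' t)"
    "L2_norm T (\<lambda>t. wderiv T 1 u t - wderiv T 1 u' t) = L2_norm T (\<lambda>t. V t - V' t)"
    "L2_norm T (\<lambda>t. wderiv T 2 u t - wderiv T 2 u' t) = L2_norm T (\<lambda>t. g t - g' t)"
proof -
  note w = H20_rep_wderiv[OF assms(1,3)] and w' = H20_rep_wderiv[OF assms(2,3)]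
  note d = H20_repD[OF H20_rep_diff[OF assms(1,2)]]
  show "L2_norm T (\<lambda>t. wderiv T 0 u t - wderiv T 0 u' t) = L2_norm T (\<lambda>t. U t - U' t)"
    by (rule L2_norm_cong[symmetric, OF d(5) ae_eq_sym[OF ae_eq_diff[OF w(1) w'(1)]]])
  show "L2_norm T (\<lambda>t. wderiv T 1 u t - wderiv T 1 u' t) = L2_norm T (\<lambda>t. V t - V' t)"
    by (rule L2_norm_cong[symmetric, OF d(6) ae_eq_sym[OF ae_eq_diff[OF w(2) w'(2)]]])
  show "L2_norm T (\<lambda>t. wderiv T 2 u t - wderiv T 2 u' t) = L2_norm T (\<lambda>t. g t - g' t)"
    by (rule L2_norm_cong[symmetric, OF d(7) ae_eq_sym[OF ae_eq_diff[OF w(3) w'(3)]]])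
qed

lemma wderiv_L2:
  assumes "H20_rep T u U V g" "0 < T"
  shows "wderiv T 0 u \<in> L2_space T" "wderiv T 1 u \<in> L2_space T" "wderiv T 2 u \<in> L2_space T"
  by (rule L2_space_cong[OF H20_repD(5)[OF assms(1)] ae_eq_sym[OF H20_rep_wderiv(1)[OF assms]]]
      L2_space_cong[OF H20_repD(6)[OF assms(1)] ae_eq_sym[OF H20_rep_wderiv(2)[OF assms]]]
      L2_space_cong[OF H20_repD(7)[OF assms(1)] ae_eq_sym[OF H20_rep_wderiv(3)[OF assms]]])+

section \<open>The form and the operator on representatives\<close>

lemma a_form_H20_rep:
  assumes u: "H20_rep T u U V g" and w: "H20_rep T w W W1 W2" and T: "0 < T"
  shows "a_form T \<mu> u w = L2_inner T g W1 + V 0 * W1 0 + \<mu> * L2_inner T U W1"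
proof -
  have "L2_inner T (wderiv T 2 u) (wderiv T 1 w) = L2_inner T g W1"
    by (rule L2_inner_cong[OF wderiv_L2(3)[OF u T] wderiv_L2(2)[OF w T] H20_rep_wderiv(3)[OF u T] H20_rep_wderiv(2)[OF w T]])
  moreover have "L2_inner T u (wderiv T 1 w) = L2_inner T U W1"
    by (rule L2_inner_cong[OF H20_repD(8)[OF u] wderiv_L2(2)[OF w T] H20_repD(4)[OF u] H20_rep_wderiv(2)[OF w T]])
  moreover have "trace_at T (wderiv T 1 u) 0 = V 0" "trace_at T (wderiv T 1 w) 0 = W1 0"
    using T H20_rep_trace(2)[OF u T, of 0] H20_rep_trace(2)[OF w T, of 0] by simp_all
  ultimately show ?thesis
    by (simp add: a_form_def)
qed

lemma primitive_exp_weight: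
  assumes "primitive T F f" "0 < T"
  shows "primitive T (\<lambda>t. exp (- t / T) * F t) (\<lambda>t. exp (- t / T) * f t - exp (- t / T) * F t / T)"
proof -
  have "primitive T (\<lambda>t. exp (- t / T)) (\<lambda>t. exp (- t / T) * (- 1 / T))"
    by (rule primitive_C1) (use assms(2) in \<open>auto intro!: derivative_eq_intros continuous_intros\<close>)
  from primitive_mult[OF this assms(1)] show ?thesis
    by (simp add: algebra_simps)
qed

lemma integral_cong_ae_eq:
  assumes "h \<in> L2_space T" "ae_eq T h h'" "t \<le> T"
  shows "integral {0..t} h = integral {0..t} h'"
proof -
  have h': "h' \<in> L2_space T"
    by (rule L2_space_cong[OF assms(1,2)])
  have "ae_eq t h h'"
    using assms(2,3) unfolding ae_eq_def AE_leb_iff by (auto elim: eventually_mono)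
  then have "L2_inner t h (\<lambda>_. 1) = L2_inner t h' (\<lambda>_. 1)"
    by (intro L2_inner_cong L2_space_mono[OF assms(1,3)] L2_const ae_eq_refl)
  then show ?thesis
    using LINT_leb[OF L2_integrable[OF L2_space_mono[OF assms(1,3)]]]
      LINT_leb[OF L2_integrable[OF L2_space_mono[OF h' assms(3)]]] by (simp add: L2_inner_def)
qed

lemma L_op_H20_rep:
  assumes w: "H20_rep T w W W1 W2" and T: "0 < T"
  obtains L where "H20_rep T (L_op T w) L (\<lambda>t. exp (- t / T) * W1 t) (\<lambda>t. exp (- t / T) * W2 t - exp (- t / T) * W1 t / T)"
proof -
  define L where "L t = integral {0..t} (\<lambda>t. exp (- t / T) * W1 t)" for t
  have e: "continuous_on {0..T} (\<lambda>t. exp (- t / T))"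
    using T by (intro continuous_intros) simp
  have L2: "(\<lambda>t. exp (- t / T) * W1 t) \<in> L2_space T" "(\<lambda>t. exp (- t / T) * wderiv T 1 w t) \<in> L2_space T"
    by (rule L2_mult_bounded[OF e] H20_repD(6)[OF w] wderiv_L2(2)[OF w T])+
  have ae: "ae_eq T (\<lambda>t. exp (- t / T) * wderiv T 1 w t) (\<lambda>t. exp (- t / T) * W1 t)"
    by (rule ae_eq_mult[OF ae_eq_refl H20_rep_wderiv(2)[OF w T]])
  have "L_op T w t = L t" if "t \<le> T" for t
  proof -
    have "(\<lambda>t. exp (- t / T) * wderiv T 1 w t) absolutely_integrable_on {0..t}"
      using L2_integrable[OF L2_space_mono[OF L2(2) that]] by (simp add: integrable_leb_iff)
    then have "integrable (lebesgue_on {0..t}) (\<lambda>t. exp (- t / T) * wderiv T 1 w t)"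
      unfolding set_integrable_def by (subst integrable_restrict_space) simp_all
    then have "L_op T w t = integral {0..t} (\<lambda>t. exp (- t / T) * wderiv T 1 w t)"
      unfolding L_op_def by (rule lebesgue_integral_eq_integral) simp
    then show ?thesis
      unfolding L_def integral_cong_ae_eq[OF L2(2) ae that] .
  qed
  then have "ae_eq T (L_op T w) L"
    unfolding ae_eq_def AE_leb_iff by simp
  moreover have "primitive T L (\<lambda>t. exp (- t / T) * W1 t)"
    using primitive_integral[OF L2(1), of 0] by (simp add: L_def[abs_def])
  moreover have "L 0 = 0"
    by (simp add: L_def)
  ultimately show ?thesis
    using primitive_exp_weight[OF H20_repD(2)[OF w] T] by (intro that) (simp add: H20_rep_def)
qed

text \<open>This makes the dual solution admissible in the approximation property with s = 2, whose
  right-hand side contains the third derivative.\<close>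

lemma H20_Hk3:
  assumes "primitive T Z Z1" "primitive T Z1 Z2" "primitive T Z2 Z3" "Z 0 = 0" "0 < T"
  shows "H20_rep T Z Z Z1 Z2" "Z \<in> H20 T \<inter> Hk T 3" "ae_eq T (wderiv T 3 Z) Z3"
proof -
  show r: "H20_rep T Z Z Z1 Z2"
    using assms by (simp add: H20_rep_def ae_eq_refl)
  have "is_weak_deriv T 2 Z1 Z3"
    using is_weak_deriv_Suc[OF assms(5) primitive_is_weak_deriv[OF assms(2,5)] primitive_is_weak_deriv[OF assms(3,5)]]
    by (simp add: numeral_2_eq_2)
  then have w3: "is_weak_deriv T 3 Z Z3"
    using is_weak_deriv_Suc[OF assms(5) primitive_is_weak_deriv[OF assms(1,5)]] by (simp add: numeral_3_eq_3 numeral_2_eq_2)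
  then show "ae_eq T (wderiv T 3 Z) Z3"
    by (rule wderiv_ae_eq[OF assms(5)])
  note w = H20_rep_weak_deriv[OF r assms(5)] and d = H20_repD[OF r]
  have "\<exists>g\<in>L2_space T. is_weak_deriv T j Z g" if "j \<le> 3" for j
  proof -
    from that have "j = 0 \<or> j = 1 \<or> j = 2 \<or> j = 3"
      by auto
    with w w3 d primitiveD(1)[OF assms(3)] show ?thesis
      by blast
  qed
  then show "Z \<in> H20 T \<inter> Hk T 3"
    using H20_rep_imp_H20[OF r assms(5)] d(8) by (simp add: sobolev_over_def)
qed

section \<open>Trace inequality and the weighted bilinear form\<close>

lemma L2_norm_mono:
  assumes "f \<in> L2_space T" "t \<le> T"
  shows "L2_norm t f \<le> L2_norm T f"
proof -
  have "(\<lambda>s. f s * f s) integrable_on {0..r}" if "f \<in> L2_space r" for r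
    using L2_spaceD(2)[OF that] unfolding integrable_leb_iff by (rule set_lebesgue_integral_eq_integral(1))
  then have i: "(\<lambda>s. f s * f s) integrable_on {0..t}" "(\<lambda>s. f s * f s) integrable_on {0..T}"
    using assms L2_space_mono by blast+
  have "integral {0..t} (\<lambda>s. f s * f s) \<le> integral {0..T} (\<lambda>s. f s * f s)"
    by (rule integral_subset_le) (use i assms(2) in auto)
  then show ?thesis
    unfolding L2_norm_def L2_inner_def
      LINT_leb[OF L2_spaceD(2)[OF assms(1)]] LINT_leb[OF L2_spaceD(2)[OF L2_space_mono[OF assms]]]
    by (rule real_sqrt_le_mono)
qed

lemma integral_le_L2_norm:
  assumes "f \<in> L2_space T" "0 \<le> t" "t \<le> T"
  shows "\<bar>integral {0..t} f\<bar> \<le> sqrt T * L2_norm T f"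
proof (cases "t = 0")
  case True
  then show ?thesis
    using assms by (simp add: L2_norm_nonneg)
next
  case False
  note ft = L2_space_mono[OF assms(1,3)]
  have "\<bar>integral {0..t} f\<bar> = \<bar>L2_inner t f (\<lambda>_. 1)\<bar>"
    using LINT_leb[OF L2_integrable[OF ft]] by (simp add: L2_inner_def)
  also have "\<dots> \<le> L2_norm t f * L2_norm t (\<lambda>_. 1)"
    by (rule L2_Cauchy_Schwarz[OF ft L2_const])
  also have "\<dots> = L2_norm t f * sqrt t"
    using False assms by (simp add: L2_norm_const)
  also have "\<dots> \<le> L2_norm T f * sqrt T"
    using assms by (intro mult_mono L2_norm_mono) (auto simp: L2_norm_nonneg)
  finally show ?thesis
    by (simp add: mult.commute)
qed

text \<open>One factor \<open>sqrt T\<close> comes from the pointwise Cauchy-Schwarz bound on U, the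
  other from the norm of a constant.\<close>

lemma Poincare:
  assumes "primitive T U V" "U 0 = 0" "0 < T"
  shows "L2_norm T U \<le> T * L2_norm T V"
proof -
  let ?c = "sqrt T * L2_norm T V"
  have "\<bar>U t\<bar> \<le> ?c" if "0 < t" "t < T" for t
    using integral_le_L2_norm[OF primitiveD(1)[OF assms(1)], of t] primitiveD(2)[OF assms(1), of t] assms(2) that
    by simp
  then have "L2_norm T U \<le> L2_norm T (\<lambda>_. ?c)"
    by (intro L2_norm_le_pointwise primitive_L2[OF assms(1)] L2_const) fastforce
  also have "\<dots> = sqrt T * sqrt T * L2_norm T V"
    using assms(3) by (simp add: L2_norm_const L2_norm_nonneg abs_mult mult.commute)
  finally show ?thesis
    using assms(3) by simp
qed

text \<open>Integrate \<open>(F\<^sup>2)'\<close> against \<open>1 - t / T\<close>, which removes the boundary term at \<open>T\<close>.\<close>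

lemma trace_bound:
  assumes F: "primitive T F f" and T: "0 < T"
  shows "(F 0)\<^sup>2 \<le> (L2_norm T F)\<^sup>2 / T + 2 * (L2_norm T F * L2_norm T f)"
proof -
  let ?G = "\<lambda>t. 1 - t / T"
  have G: "primitive T ?G (\<lambda>_. - 1 / T)"
    by (rule primitive_C1) (use T in \<open>auto intro!: derivative_eq_intros\<close>)
  note L2 = primitiveD(1)[OF F] primitive_L2[OF F]
  have FG: "(\<lambda>t. ?G t * F t) \<in> L2_space T"
    by (rule L2_mult_bounded[OF primitive_continuous[OF G] L2(2)])
  have "L2_inner T (\<lambda>t. f t * F t + F t * f t) ?G + L2_inner T (\<lambda>t. F t * F t) (\<lambda>_. - 1 / T) = - (F 0)\<^sup>2"
    using integral_by_parts_primitive[OF primitive_mult[OF F F] G] T by (simp add: power2_eq_square)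
  moreover have "L2_inner T (\<lambda>t. f t * F t + F t * f t) ?G = 2 * L2_inner T f (\<lambda>t. ?G t * F t)"
    unfolding L2_inner_def integral_mult_right_zero[symmetric]
    by (rule Bochner_Integration.integral_cong) (simp_all add: algebra_simps)
  moreover have "L2_inner T (\<lambda>t. F t * F t) (\<lambda>_. - 1 / T) = - (L2_norm T F)\<^sup>2 / T"
    using integral_mult_left_zero[of "leb T" "\<lambda>t. F t * F t" "- 1 / T"]
    unfolding L2_norm_power2 L2_inner_def by simp
  moreover have "\<bar>L2_inner T f (\<lambda>t. ?G t * F t)\<bar> \<le> L2_norm T f * L2_norm T F"
  proof -
    have "\<bar>?G t * F t\<bar> \<le> \<bar>F t\<bar>" if "0 < t" "t < T" for t
    proof -
      have "\<bar>?G t\<bar> \<le> 1"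
        using that by (simp add: abs_le_iff field_simps)
      then show ?thesis
        by (simp add: abs_mult mult_left_le_one_le)
    qed
    then have "L2_norm T (\<lambda>t. ?G t * F t) \<le> L2_norm T F"
      by (intro L2_norm_le_pointwise FG L2(2))
    then show ?thesis
      using L2_Cauchy_Schwarz[OF L2(1) FG] L2_norm_nonneg[of T f]
      by (meson mult_left_mono order_trans)
  qed
  ultimately show ?thesis
    by (simp add: abs_le_iff mult.commute)
qed

section \<open>Exponentially weighted products and coercivity\<close>

lemma exp_weight_continuous: "0 < T \<Longrightarrow> continuous_on A (\<lambda>t. exp (- t / T))"
  for T :: real
  by (intro continuous_intros) simp

lemma exp_weight_L2:
  "f \<in> L2_space T \<Longrightarrow> 0 < T \<Longrightarrow> (\<lambda>t. exp (- t / T) * f t) \<in> L2_space T"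
  by (rule L2_mult_bounded[OF exp_weight_continuous])

lemma exp_weight_norm_le:
  assumes "f \<in> L2_space T" "0 < T"
  shows "L2_norm T (\<lambda>t. exp (- t / T) * f t) \<le> L2_norm T f"
  using assms by (intro L2_norm_le_pointwise exp_weight_L2) (auto simp: abs_mult mult_left_le_one_le)

lemma exp_weight_Cauchy_Schwarz:
  assumes "f \<in> L2_space T" "g \<in> L2_space T" "0 < T"
  shows "\<bar>L2_inner T f (\<lambda>t. exp (- t / T) * g t)\<bar> \<le> L2_norm T f * L2_norm T g"
  using L2_Cauchy_Schwarz[OF assms(1) exp_weight_L2[OF assms(2,3)]]
    mult_left_mono[OF exp_weight_norm_le[OF assms(2,3)] L2_norm_nonneg[of T f]] by linarith

lemma exp_weight_lower_bound:
  assumes "f \<in> L2_space T" "0 < T"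
  shows "exp (- 1) * (L2_norm T f)\<^sup>2 \<le> L2_inner T f (\<lambda>t. exp (- t / T) * f t)"
proof -
  have "(LINT t|leb T. exp (- 1) * (f t * f t)) \<le> (LINT t|leb T. f t * (exp (- t / T) * f t))"
  proof (rule integral_mono)
    show "integrable (leb T) (\<lambda>t. exp (- 1) * (f t * f t))"
      using L2_spaceD(2)[OF assms(1)] by simp
    show "integrable (leb T) (\<lambda>t. f t * (exp (- t / T) * f t))"
      by (rule L2_mult_integrable[OF assms(1) exp_weight_L2[OF assms]])
    fix t assume "t \<in> space (leb T)"
    then have "exp (- 1) * (f t * f t) \<le> exp (- t / T) * (f t * f t)"
      using assms(2) by (intro mult_right_mono) (auto simp: field_simps)
    then show "exp (- 1) * (f t * f t) \<le> f t * (exp (- t / T) * f t)"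
      by (simp add: algebra_simps)
  qed
  then show ?thesis
    unfolding L2_norm_power2 L2_inner_def by simp
qed

text \<open>Integration of (F^2)' against the weight; the last term, with its factor 1/T, is minus
  the derivative of the weight and is the source of coercivity.\<close>

lemma exp_weight_energy:
  assumes F: "primitive T F f" and T: "0 < T"
  shows "2 * L2_inner T f (\<lambda>t. exp (- t / T) * F t) =
    exp (- 1) * (F T)\<^sup>2 - (F 0)\<^sup>2 + L2_inner T F (\<lambda>t. exp (- t / T) * F t) / T"
proof -
  note L2 = primitiveD(1)[OF F] primitive_L2[OF F]
  have "L2_inner T f (\<lambda>t. exp (- t / T) * F t) + L2_inner T F (\<lambda>t. exp (- t / T) * f t - exp (- t / T) * F t / T) =
      F T * (exp (- T / T) * F T) - F 0 * (exp (- 0 / T) * F 0)"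
    by (rule integral_by_parts_primitive[OF F primitive_exp_weight[OF F T]]) (use T in simp)
  moreover have "L2_inner T F (\<lambda>t. exp (- t / T) * f t - (1 / T) * (exp (- t / T) * F t)) =
      L2_inner T F (\<lambda>t. exp (- t / T) * f t) - L2_inner T F (\<lambda>t. (1 / T) * (exp (- t / T) * F t))"
    by (rule L2_inner_diff_right) (intro L2 exp_weight_L2 T L2_cmult)+
  moreover have "L2_inner T F (\<lambda>t. (1 / T) * (exp (- t / T) * F t)) = (1 / T) * L2_inner T F (\<lambda>t. exp (- t / T) * F t)"
    using L2_inner_cmult[of T "1 / T"] by (simp add: L2_inner_commute[of T F])
  moreover have "L2_inner T F (\<lambda>t. exp (- t / T) * f t) = L2_inner T f (\<lambda>t. exp (- t / T) * F t)"
    by (simp add: L2_inner_def mult.commute mult.left_commute)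
  ultimately show ?thesis
    using T by (simp add: power2_eq_square algebra_simps)
qed

text \<open>\<open>a\<^sub>\<mu>(u, \<L>\<^sub>T w)\<close> for \<open>u\<close> represented by \<open>U\<close>, \<open>V\<close>, \<open>g\<close> and \<open>W1 = \<partial>\<^sub>t w\<close>.\<close>

definition weighted_form :: "real \<Rightarrow> real \<Rightarrow> (real \<Rightarrow> real) \<Rightarrow> (real \<Rightarrow> real) \<Rightarrow> (real \<Rightarrow> real) \<Rightarrow> (real \<Rightarrow> real) \<Rightarrow> real" where
  "weighted_form T \<mu> U V g W1 =
     L2_inner T g (\<lambda>t. exp (- t / T) * W1 t) + V 0 * W1 0 + \<mu> * L2_inner T U (\<lambda>t. exp (- t / T) * W1 t)"

lemma weighted_form_diff_left:
  assumes "U \<in> L2_space T" "g \<in> L2_space T" "U' \<in> L2_space T" "g' \<in> L2_space T" "W1 \<in> L2_space T" "0 < T"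
  shows "weighted_form T \<mu> (\<lambda>t. U t - U' t) (\<lambda>t. V t - V' t) (\<lambda>t. g t - g' t) W1 =
    weighted_form T \<mu> U V g W1 - weighted_form T \<mu> U' V' g' W1"
proof -
  note e = exp_weight_L2[OF assms(5,6)]
  show ?thesis
    unfolding weighted_form_def L2_inner_diff_left[OF assms(1,3) e] L2_inner_diff_left[OF assms(2,4) e]
    by (simp only: algebra_simps)
qed

lemma weighted_form_diff_right:
  assumes "U \<in> L2_space T" "g \<in> L2_space T" "W \<in> L2_space T" "W' \<in> L2_space T" "0 < T"
  shows "weighted_form T \<mu> U V g (\<lambda>t. W t - W' t) = weighted_form T \<mu> U V g W - weighted_form T \<mu> U V g W'"
proof -
  have "L2_inner T f (\<lambda>t. exp (- t / T) * (W t - W' t)) =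
      L2_inner T f (\<lambda>t. exp (- t / T) * W t) - L2_inner T f (\<lambda>t. exp (- t / T) * W' t)"
    if "f \<in> L2_space T" for f
    unfolding right_diff_distrib by (rule L2_inner_diff_right[OF exp_weight_L2 exp_weight_L2 that]) (rule assms)+
  then show ?thesis
    using assms by (simp add: weighted_form_def right_diff_distrib del: exp_minus_inverse)
qed

lemma a_form_L_op:
  assumes u: "H20_rep T u U V g" and w: "H20_rep T w W W1 W2" and T: "0 < T"
  shows "a_form T \<mu> u (L_op T w) = weighted_form T \<mu> U V g W1"
proof -
  obtain L where L: "H20_rep T (L_op T w) L (\<lambda>t. exp (- t / T) * W1 t) (\<lambda>t. exp (- t / T) * W2 t - exp (- t / T) * W1 t / T)"
    using L_op_H20_rep[OF w T] .
  show ?thesis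
    using a_form_H20_rep[OF u L T] by (simp add: weighted_form_def)
qed

lemma L_op_in_H20:
  assumes "w \<in> H20 T" "0 < T"
  shows "L_op T w \<in> H20 T"
proof -
  obtain W W1 W2 where "H20_rep T w W W1 W2"
    using H20_rep_exists[OF assms] .
  then show ?thesis
  proof (rule L_op_H20_rep[OF _ assms(2)])
    fix L assume "H20_rep T (L_op T w) L (\<lambda>t. exp (- t / T) * W1 t) (\<lambda>t. exp (- t / T) * W2 t - exp (- t / T) * W1 t / T)"
    then show ?thesis
      using assms(2) by (rule H20_rep_imp_H20)
  qed
qed

text \<open>\<open>exp_weight_energy\<close> is used twice: for V, where half of V(0)^2 survives the
  cancellation with the boundary term, and for U, where it makes the \<mu> term nonnegative. The
  constant is therefore independent of \<mu>.\<close>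

lemma weighted_form_coercive:
  assumes "primitive T U V" "primitive T V g" "U 0 = 0" "0 < T" "0 \<le> \<mu>"
  shows "exp (- 1) / (2 * T) * (L2_norm T V)\<^sup>2 \<le> weighted_form T \<mu> U V g V"
proof -
  \<comment> \<open>Here G is the second-order term, v = V(0)^2, m the \<mu> term, q the square at
    T, A the bulk term divided by T and a its lower bound.\<close>
  have arith: "x \<le> G + v + m" if "0 \<le> m" "a \<le> A" "0 \<le> q" "0 \<le> v" "x = a / 2" "2 * G = q - v + A"
    for x G v m q A a :: real
    using that by linarith
  have V: "V \<in> L2_space T" and U: "U \<in> L2_space T"
    by (rule primitive_L2[OF assms(2)] primitive_L2[OF assms(1)])+
  have "0 \<le> L2_inner T U (\<lambda>t. exp (- t / T) * U t)"
    using exp_weight_lower_bound[OF U assms(4)] by (rule order_trans[rotated]) simp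
  then have "0 \<le> exp (- 1) * (U T)\<^sup>2 + L2_inner T U (\<lambda>t. exp (- t / T) * U t) / T"
    using assms(4) by simp
  then have "0 \<le> 2 * L2_inner T V (\<lambda>t. exp (- t / T) * U t)"
    using exp_weight_energy[OF assms(1,4)] assms(3) by simp
  moreover have "L2_inner T U (\<lambda>t. exp (- t / T) * V t) = L2_inner T V (\<lambda>t. exp (- t / T) * U t)"
    by (simp add: L2_inner_def mult.commute mult.left_commute)
  ultimately have "0 \<le> \<mu> * L2_inner T U (\<lambda>t. exp (- t / T) * V t)"
    using assms(5) by simp
  moreover have "exp (- 1) * (L2_norm T V)\<^sup>2 / T \<le> L2_inner T V (\<lambda>t. exp (- t / T) * V t) / T"
    using exp_weight_lower_bound[OF V assms(4)] assms(4) by (simp add: divide_right_mono)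
  moreover have "0 \<le> exp (- 1) * (V T)\<^sup>2" "0 \<le> (V 0)\<^sup>2"
    by simp_all
  moreover have "exp (- 1) / (2 * T) * (L2_norm T V)\<^sup>2 = (exp (- 1) * (L2_norm T V)\<^sup>2 / T) / 2"
    by simp
  ultimately show ?thesis
    using exp_weight_energy[OF assms(2,4)] arith unfolding weighted_form_def power2_eq_square[of "V 0", symmetric]
    by blast
qed

text \<open>Integration by parts produces -V(0) W1(0), which cancels against the boundary term of
  the form. V(T) = 0 and the weighted orthogonality remove the rest, except for the 1/T term left by
  differentiating the weight.\<close>

lemma weighted_form_projection_error:
  assumes "primitive T V g" "primitive T W1 W2" "V T = 0" "0 < T"
    and "L2_inner T V (\<lambda>t. exp (- t / T) * W2 t) = 0"
  shows "weighted_form T \<mu> U V g W1 =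
    L2_inner T V (\<lambda>t. exp (- t / T) * W1 t) / T + \<mu> * L2_inner T U (\<lambda>t. exp (- t / T) * W1 t)"
proof -
  note L2 = primitiveD(1)[OF assms(2)] primitive_L2[OF assms(2)] primitive_L2[OF assms(1)]
  have "L2_inner T g (\<lambda>t. exp (- t / T) * W1 t) + L2_inner T V (\<lambda>t. exp (- t / T) * W2 t - exp (- t / T) * W1 t / T) =
      V T * (exp (- T / T) * W1 T) - V 0 * (exp (- 0 / T) * W1 0)"
    by (rule integral_by_parts_primitive[OF assms(1) primitive_exp_weight[OF assms(2,4)]]) (use assms(4) in simp)
  moreover have "L2_inner T V (\<lambda>t. exp (- t / T) * W2 t - (1 / T) * (exp (- t / T) * W1 t)) =
      L2_inner T V (\<lambda>t. exp (- t / T) * W2 t) - L2_inner T V (\<lambda>t. (1 / T) * (exp (- t / T) * W1 t))"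
    by (rule L2_inner_diff_right) (intro L2 exp_weight_L2 assms L2_cmult)+
  moreover have "L2_inner T V (\<lambda>t. (1 / T) * (exp (- t / T) * W1 t)) = (1 / T) * L2_inner T V (\<lambda>t. exp (- t / T) * W1 t)"
    using L2_inner_cmult[of T "1 / T"] by (simp add: L2_inner_commute[of T V])
  ultimately show ?thesis
    using assms(3,5) by (simp add: weighted_form_def)
qed

section \<open>The dual problem\<close>

text \<open>
  Variation of constants for \<open>q'' + \<omega>\<^sup>2 q = E\<close>, \<open>q(T) = q'(T) = 0\<close>:
  \<open>q(t) = \<integral>\<^sub>t\<^sup>T sin (\<omega> (s - t)) E(s) ds / \<omega>\<close>, with the sine expanded by the addition theorem.
\<close>

lemma oscillator_backward:
  assumes E: "E \<in> L2_space T" and T: "0 < T" and \<omega>: "0 < \<omega>"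
  obtains q q1 where "primitive T q q1" "primitive T q1 (\<lambda>t. E t - \<omega>\<^sup>2 * q t)" "q T = 0" "q1 T = 0"
    "\<And>t. 0 \<le> t \<Longrightarrow> t \<le> T \<Longrightarrow> \<bar>q t\<bar> \<le> 4 * sqrt T / \<omega> * L2_norm T E"
    "\<And>t. 0 \<le> t \<Longrightarrow> t \<le> T \<Longrightarrow> \<bar>q1 t\<bar> \<le> 4 * sqrt T * L2_norm T E"
proof -
  define tail where "tail k t = integral {0..T} (\<lambda>s. k s * E s) - integral {0..t} (\<lambda>s. k s * E s)" for k t
  have tail_prim: "primitive T (tail k) (\<lambda>t. - (k t * E t))" and
    tail_bound: "\<And>t. 0 \<le> t \<Longrightarrow> t \<le> T \<Longrightarrow> \<bar>tail k t\<bar> \<le> 2 * sqrt T * L2_norm T E"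
    if k: "continuous_on {0..T} k" "\<And>t. \<bar>k t\<bar> \<le> 1" for k
  proof -
    have kE: "(\<lambda>s. k s * E s) \<in> L2_space T"
      by (rule L2_mult_bounded[OF k(1) E])
    have "primitive T (\<lambda>t. integral {0..t} (\<lambda>s. k s * E s)) (\<lambda>s. k s * E s)"
      using primitive_integral[OF kE, of 0] by simp
    from primitive_diff[OF primitive_const this] show "primitive T (tail k) (\<lambda>t. - (k t * E t))"
      by (rule primitive_transform) (auto simp: tail_def)
    have "L2_norm T (\<lambda>s. k s * E s) \<le> L2_norm T E"
      using k(2) by (intro L2_norm_le_pointwise kE E) (simp add: abs_mult mult_left_le_one_le)
    then have le: "sqrt T * L2_norm T (\<lambda>s. k s * E s) \<le> sqrt T * L2_norm T E"
      using T by (intro mult_left_mono) auto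
    \<comment> \<open>The factor 2 arises because the tail is a difference of two integrals from 0,
      each bounded separately; q and q1 double it once more.\<close>
    show "\<bar>tail k t\<bar> \<le> 2 * sqrt T * L2_norm T E" if "0 \<le> t" "t \<le> T" for t
      using integral_le_L2_norm[OF kE, of T] integral_le_L2_norm[OF kE that] le T
      unfolding tail_def by linarith
  qed
  define a b where "a = tail (\<lambda>s. sin (\<omega> * s))" and "b = tail (\<lambda>s. cos (\<omega> * s))"
  have c: "continuous_on {0..T} (\<lambda>s. sin (\<omega> * s))" "continuous_on {0..T} (\<lambda>s. cos (\<omega> * s))"
    by (intro continuous_intros)+
  have a: "primitive T a (\<lambda>t. - (sin (\<omega> * t) * E t))" "\<And>t. 0 \<le> t \<Longrightarrow> t \<le> T \<Longrightarrow> \<bar>a t\<bar> \<le> 2 * sqrt T * L2_norm T E"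
    and b: "primitive T b (\<lambda>t. - (cos (\<omega> * t) * E t))" "\<And>t. 0 \<le> t \<Longrightarrow> t \<le> T \<Longrightarrow> \<bar>b t\<bar> \<le> 2 * sqrt T * L2_norm T E"
    unfolding a_def b_def by (rule tail_prim tail_bound c abs_sin_le_one abs_cos_le_one; assumption?)+
  have T0: "a T = 0" "b T = 0"
    by (simp_all add: a_def b_def tail_def)
  have S: "primitive T (\<lambda>t. sin (\<omega> * t)) (\<lambda>t. \<omega> * cos (\<omega> * t))" and C: "primitive T (\<lambda>t. cos (\<omega> * t)) (\<lambda>t. - \<omega> * sin (\<omega> * t))"
    by (rule primitive_C1; auto intro!: derivative_eq_intros continuous_intros)+
  define q where "q t = (1 / \<omega>) * (cos (\<omega> * t) * a t) + (- 1 / \<omega>) * (sin (\<omega> * t) * b t)" for t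
  \<comment> \<open>In the derivative of q the contributions of a' and b' cancel; in that of q1 they
    add up to E since sin^2 + cos^2 = 1.\<close>
  define q1 where "q1 t = (- 1) * (sin (\<omega> * t) * a t) + (- 1) * (cos (\<omega> * t) * b t)" for t
  have "primitive T q q1"
    unfolding q_def[abs_def]
    by (rule primitive_transform[OF primitive_add[OF primitive_mult[OF C a(1)] primitive_mult[OF S b(1)], of "1 / \<omega>" "- 1 / \<omega>"] refl])
      (use \<omega> in \<open>simp add: q1_def field_simps\<close>)
  moreover have "primitive T q1 (\<lambda>t. E t - \<omega>\<^sup>2 * q t)"
    unfolding q1_def[abs_def]
  proof (rule primitive_transform[OF primitive_add[OF primitive_mult[OF S a(1)] primitive_mult[OF C b(1)], of "- 1" "- 1"] refl])
    fix t
    have "\<omega>\<^sup>2 * q t = \<omega> * (cos (\<omega> * t) * a t) - \<omega> * (sin (\<omega> * t) * b t)"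
      using \<omega> by (simp add: q_def power2_eq_square field_simps)
    moreover have "(sin (\<omega> * t) * sin (\<omega> * t) + cos (\<omega> * t) * cos (\<omega> * t)) * E t = E t"
      using sin_cos_squared_add3[of "\<omega> * t"] by (simp only: add.commute[of "sin _ * _"] mult_1_left)
    moreover have "- 1 * (\<omega> * cos (\<omega> * t) * a t + sin (\<omega> * t) * - (sin (\<omega> * t) * E t)) +
        - 1 * (- \<omega> * sin (\<omega> * t) * b t + cos (\<omega> * t) * - (cos (\<omega> * t) * E t)) =
        (sin (\<omega> * t) * sin (\<omega> * t) + cos (\<omega> * t) * cos (\<omega> * t)) * E t -
        (\<omega> * (cos (\<omega> * t) * a t) - \<omega> * (sin (\<omega> * t) * b t))"
      by (simp add: algebra_simps del: sin_cos_squared_add3)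
    ultimately show "- 1 * (\<omega> * cos (\<omega> * t) * a t + sin (\<omega> * t) * - (sin (\<omega> * t) * E t)) +
        - 1 * (- \<omega> * sin (\<omega> * t) * b t + cos (\<omega> * t) * - (cos (\<omega> * t) * E t)) = E t - \<omega>\<^sup>2 * q t"
      by (simp only:)
  qed
  moreover have "q T = 0" "q1 T = 0"
    by (simp_all add: q_def q1_def T0)
  moreover have prod: "\<bar>r * a t\<bar> \<le> 2 * sqrt T * L2_norm T E" "\<bar>r * b t\<bar> \<le> 2 * sqrt T * L2_norm T E"
    if "0 \<le> t" "t \<le> T" "\<bar>r\<bar> \<le> 1" for r t
    using mult_mono[OF that(3) a(2)[OF that(1,2)]] mult_mono[OF that(3) b(2)[OF that(1,2)]]
    by (simp_all add: abs_mult)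
  moreover have "\<bar>q1 t\<bar> \<le> 4 * sqrt T * L2_norm T E" if "0 \<le> t" "t \<le> T" for t
    using prod(1)[OF that abs_sin_le_one[of "\<omega> * t"]] prod(2)[OF that abs_cos_le_one[of "\<omega> * t"]]
    unfolding q1_def by linarith
  moreover have "\<bar>q t\<bar> \<le> 4 * sqrt T / \<omega> * L2_norm T E" if "0 \<le> t" "t \<le> T" for t
  proof -
    have "q t = (cos (\<omega> * t) * a t - sin (\<omega> * t) * b t) / \<omega>"
      by (simp add: q_def diff_divide_distrib)
    then have "\<bar>q t\<bar> = \<bar>cos (\<omega> * t) * a t - sin (\<omega> * t) * b t\<bar> / \<omega>"
      using \<omega> by simp
    also have "\<dots> \<le> (4 * sqrt T * L2_norm T E) / \<omega>"
      using prod(1)[OF that abs_cos_le_one[of "\<omega> * t"]] prod(2)[OF that abs_sin_le_one[of "\<omega> * t"]] \<omega>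
      by (intro divide_right_mono) linarith+
    finally show ?thesis
      by simp
  qed
  ultimately show ?thesis
    using that by blast
qed

text \<open>Bounds e^(t/T) (q/T^2 + 2 q'/T + E - \<mu> q), the third derivative of z. The inner sum
  collects the sup bounds of the three terms in q and q', \<open>exp 1\<close> bounds the
  exponential, and the last \<open>sqrt T\<close> is the norm of the constant 1.\<close>

definition dual_bound :: "real \<Rightarrow> real \<Rightarrow> real" where
  "dual_bound T \<omega> = exp 1 * (1 + (4 * sqrt T / (\<omega> * T\<^sup>2) + 8 * sqrt T / T + 4 * sqrt T * \<omega>) * sqrt T)"

text \<open>With \<open>z' = exp (t / T) q\<close>, integrating by parts twice moves the form onto \<open>q'' + \<mu> q\<close>.\<close>

lemma dual_solution:
  assumes E: "primitive T E E1" "primitive T E1 E2" "E 0 = 0" and T: "0 < T" and \<mu>: "0 < \<mu>"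
  obtains Z Z1 Z2 Z3 where "primitive T Z Z1" "primitive T Z1 Z2" "primitive T Z2 Z3" "Z 0 = 0"
    "weighted_form T \<mu> E E1 E2 Z1 = (L2_norm T E)\<^sup>2"
    "L2_norm T Z3 \<le> dual_bound T (sqrt \<mu>) * L2_norm T E"
proof -
  define \<omega> where "\<omega> = sqrt \<mu>"
  have \<omega>: "0 < \<omega>" "\<omega>\<^sup>2 = \<mu>"
    using \<mu> by (simp_all add: \<omega>_def)
  note EL = primitive_L2[OF E(1)]
  let ?N = "L2_norm T E"
  obtain q q1 where q: "primitive T q q1" "primitive T q1 (\<lambda>t. E t - \<omega>\<^sup>2 * q t)" "q T = 0" "q1 T = 0"
    "\<And>t. 0 \<le> t \<Longrightarrow> t \<le> T \<Longrightarrow> \<bar>q t\<bar> \<le> 4 * sqrt T / \<omega> * ?N"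
    "\<And>t. 0 \<le> t \<Longrightarrow> t \<le> T \<Longrightarrow> \<bar>q1 t\<bar> \<le> 4 * sqrt T * ?N"
    using oscillator_backward[OF EL T \<omega>(1)] by blast
  define q2 where "q2 t = E t - \<mu> * q t" for t
  have q2: "primitive T q1 q2"
    using q(2) by (simp add: q2_def[abs_def] \<omega>(2))
  define e where "e t = exp (t / T)" for t
  have e: "primitive T e (\<lambda>t. e t / T)"
    unfolding e_def[abs_def] by (rule primitive_C1) (use T in \<open>auto intro!: derivative_eq_intros continuous_intros\<close>)
  define Z1 where "Z1 t = e t * q t" for t
  define Z2 where "Z2 t = e t * ((1 / T) * q t + 1 * q1 t)" for t
  define Z3 where "Z3 t = e t * (q t / T\<^sup>2 + 2 * q1 t / T + q2 t)" for t
  have Z12: "primitive T Z1 Z2"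
    unfolding Z1_def[abs_def]
    by (rule primitive_transform[OF primitive_mult[OF e q(1)] refl]) (simp add: Z2_def algebra_simps)
  have Z23: "primitive T Z2 Z3"
    unfolding Z2_def[abs_def]
    by (rule primitive_transform[OF primitive_mult[OF e primitive_add[OF q(1) q2]] refl])
      (use T in \<open>simp add: Z3_def power2_eq_square field_simps\<close>)
  define Z where "Z t = integral {0..t} Z1" for t
  have Z: "primitive T Z Z1"
    using primitive_integral[OF primitive_L2[OF Z12], of 0] by (simp add: Z_def[abs_def])
  have Z10: "Z1 0 = q 0"
    by (simp add: Z1_def e_def)
  have "exp (- t / T) * Z1 t = q t" for t
    by (simp add: Z1_def e_def flip: exp_add mult.assoc)
  then have form: "weighted_form T \<mu> E E1 E2 Z1 = L2_inner T E2 q + E1 0 * q 0 + \<mu> * L2_inner T E q"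
    by (simp add: weighted_form_def Z10)
  \<comment> \<open>The boundary terms at T vanish by the final conditions on q, the one with E(0)
    is zero, and -E1(0) q(0) cancels against the form.\<close>
  have "L2_inner T E2 q + L2_inner T E1 q1 = E1 T * q T - E1 0 * q 0"
    by (rule integral_by_parts_primitive[OF E(2) q(1)]) (use T in simp)
  moreover have "L2_inner T E1 q1 + L2_inner T E q2 = E T * q1 T - E 0 * q1 0"
    by (rule integral_by_parts_primitive[OF E(1) q2]) (use T in simp)
  moreover have "L2_inner T E q2 = L2_inner T E E - \<mu> * L2_inner T E q"
    unfolding q2_def
    using L2_inner_diff_right[OF EL L2_cmult[OF primitive_L2[OF q(1)]] EL] L2_inner_cmult_right[of T E \<mu> q]
    by simp
  ultimately have "weighted_form T \<mu> E E1 E2 Z1 = ?N\<^sup>2"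
    using form E(3) q(3,4) by (simp add: L2_norm_power2)
  moreover have "L2_norm T Z3 \<le> dual_bound T \<omega> * ?N"
  proof -
    define K where "K = 4 * sqrt T / (\<omega> * T\<^sup>2) + 8 * sqrt T / T + 4 * sqrt T * \<omega>"
    have K: "0 \<le> K"
      using T \<omega> by (simp add: K_def)
    \<comment> \<open>q and q1 are bounded uniformly by the norm of E, but q2 contains E itself,
      which is controlled in L^2 only; hence |E t| stays in the bound.\<close>
    have bound: "\<bar>Z3 t\<bar> \<le> \<bar>exp 1 * (\<bar>E t\<bar> + K * ?N)\<bar>" if t: "0 < t" "t < T" for t
    proof -
      have 1: "\<bar>q t / T\<^sup>2\<bar> \<le> 4 * sqrt T / (\<omega> * T\<^sup>2) * ?N"
        using divide_right_mono[OF q(5)[of t], of "T\<^sup>2"] t by (simp add: field_simps)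
      have 2: "\<bar>2 * q1 t / T\<bar> \<le> 8 * sqrt T / T * ?N"
        using divide_right_mono[OF q(6)[of t], of "T"] t by (simp add: abs_mult)
      have 3: "\<bar>\<mu> * q t\<bar> \<le> 4 * sqrt T * \<omega> * ?N"
      proof -
        have "\<bar>\<mu> * q t\<bar> \<le> \<mu> * (4 * sqrt T / \<omega> * ?N)"
          using mult_left_mono[OF q(5)[of t], of \<mu>] t \<mu> by (simp add: abs_mult)
        also have "\<dots> = 4 * sqrt T * \<omega> * ?N"
          unfolding \<omega>(2)[symmetric] using \<omega>(1) by (simp add: power2_eq_square)
        finally show ?thesis .
      qed
      have "\<bar>q t / T\<^sup>2 + 2 * q1 t / T + q2 t\<bar> \<le> \<bar>E t\<bar> + K * ?N"
        using 1 2 3 unfolding q2_def K_def distrib_right by linarith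
      moreover have "0 \<le> e t" "e t \<le> exp 1"
        using t by (simp_all add: e_def)
      ultimately have "e t * \<bar>q t / T\<^sup>2 + 2 * q1 t / T + q2 t\<bar> \<le> exp 1 * (\<bar>E t\<bar> + K * ?N)"
        by (intro mult_mono) auto
      then show ?thesis
        using \<open>0 \<le> e t\<close> abs_ge_self[of "exp 1 * (\<bar>E t\<bar> + K * ?N)"] unfolding Z3_def abs_mult[of "e t"]
        by linarith
    qed
    have absE: "(\<lambda>t. \<bar>E t\<bar>) \<in> L2_space T"
      by (intro continuous_on_L2 continuous_intros primitive_continuous[OF E(1)])
    have "L2_norm T Z3 \<le> L2_norm T (\<lambda>t. exp 1 * (\<bar>E t\<bar> + K * ?N))"
    proof (rule L2_norm_le_pointwise[OF primitiveD(1)[OF Z23] _ bound])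
      show "(\<lambda>t. exp 1 * (\<bar>E t\<bar> + K * ?N)) \<in> L2_space T"
        by (intro continuous_on_L2 continuous_intros primitive_continuous[OF E(1)])
    qed
    also have "\<dots> \<le> exp 1 * (L2_norm T (\<lambda>t. \<bar>E t\<bar>) + L2_norm T (\<lambda>_. K * ?N))"
      using mult_left_mono[OF L2_norm_triangle[OF absE L2_const[of "K * ?N"]], of "exp 1"]
        L2_norm_cmult[of T "exp 1" "\<lambda>t. \<bar>E t\<bar> + K * ?N"] by simp
    also have "\<dots> = exp 1 * (?N + K * ?N * sqrt T)"
      using T K by (simp add: L2_norm_const L2_norm_nonneg) (simp add: L2_norm_def L2_inner_def)
    finally show ?thesis
      by (simp add: dual_bound_def K_def algebra_simps)
  qed
  moreover have "Z 0 = 0"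
    by (simp add: Z_def)
  ultimately show ?thesis
    using that Z Z12 Z23 unfolding \<omega>_def by blast
qed

section \<open>Error estimates\<close>

text \<open>N is the projection error u - Q_h u and D the discrete difference u_h - Q_h u.
  Coercivity bounds the form below by the square of |D1|, the projection identity bounds it above by
  |N1||D1|, with \<open>Poincare\<close> turning N into N1. The factor \<open>2 * T * exp 1\<close>
  inverts the coercivity constant.\<close>

lemma discrete_error_bound:
  assumes N: "primitive T N N1" "primitive T N1 N2" "N 0 = 0" "N1 T = 0"
    and D: "primitive T D D1" "primitive T D1 D2" "D 0 = 0"
    and T: "0 < T" and \<mu>: "0 < \<mu>"
    and orth: "L2_inner T N1 (\<lambda>t. exp (- t / T) * D2 t) = 0"
    and eq: "weighted_form T \<mu> D D1 D2 D1 = weighted_form T \<mu> N N1 N2 D1"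
  shows "L2_norm T D1 \<le> 2 * T * exp 1 * (1 / T + \<mu> * T) * L2_norm T N1"
proof (cases "L2_norm T D1 = 0")
  case True
  then show ?thesis
    using T \<mu> L2_norm_nonneg[of T N1] by simp
next
  case False
  let ?x = "L2_norm T D1" and ?y = "L2_norm T N1"
  have x: "0 < ?x"
    using False L2_norm_nonneg[of T D1] by linarith
  note DL = primitive_L2[OF D(2)] and NL = primitive_L2[OF N(1)] primitive_L2[OF N(2)]
  have "exp (- 1) / (2 * T) * ?x\<^sup>2 \<le> weighted_form T \<mu> D D1 D2 D1"
    using \<mu> by (intro weighted_form_coercive D T) simp
  also have "\<dots> = L2_inner T N1 (\<lambda>t. exp (- t / T) * D1 t) / T + \<mu> * L2_inner T N (\<lambda>t. exp (- t / T) * D1 t)"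
    unfolding eq by (rule weighted_form_projection_error[OF N(2) D(2) N(4) T orth])
  also have "\<dots> \<le> (?y * ?x) / T + \<mu> * ((T * ?y) * ?x)"
  proof (intro add_mono divide_right_mono mult_left_mono)
    show "L2_inner T N1 (\<lambda>t. exp (- t / T) * D1 t) \<le> ?y * ?x"
      using exp_weight_Cauchy_Schwarz[OF NL(2) DL T] by linarith
    have "L2_inner T N (\<lambda>t. exp (- t / T) * D1 t) \<le> L2_norm T N * ?x"
      using exp_weight_Cauchy_Schwarz[OF NL(1) DL T] by linarith
    also have "\<dots> \<le> (T * ?y) * ?x"
      by (intro mult_right_mono Poincare[OF N(1,3) T] L2_norm_nonneg)
    finally show "L2_inner T N (\<lambda>t. exp (- t / T) * D1 t) \<le> (T * ?y) * ?x" .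
  qed (use T \<mu> in auto)
  also have "\<dots> = ((1 / T + \<mu> * T) * ?y) * ?x"
    by (simp add: algebra_simps)
  finally have "(exp (- 1) / (2 * T) * ?x) * ?x \<le> ((1 / T + \<mu> * T) * ?y) * ?x"
    by (simp add: power2_eq_square mult.assoc)
  then have "exp (- 1) / (2 * T) * ?x \<le> (1 / T + \<mu> * T) * ?y"
    using x by (simp only: mult_le_cancel_right_pos)
  then have "(2 * T * exp 1) * (exp (- 1) / (2 * T) * ?x) \<le> (2 * T * exp 1) * ((1 / T + \<mu> * T) * ?y)"
    using T by (intro mult_left_mono) auto
  moreover have "(2 * T * exp 1) * (exp (- 1) / (2 * T) * ?x) = ?x"
    using T by (simp add: exp_minus)
  ultimately show ?thesis
    by (simp only: mult.assoc)
qed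

text \<open>The boundary product is kept unestimated, because its order in h comes from the trace
  inequality applied to each factor.\<close>

lemma weighted_form_bound:
  assumes "primitive T E E1" "primitive T E1 E2" "E 0 = 0" "W \<in> L2_space T" "0 < T" "0 \<le> \<mu>"
  shows "weighted_form T \<mu> E E1 E2 W \<le>
    L2_norm T E2 * L2_norm T W + \<bar>E1 0 * W 0\<bar> + \<mu> * T * L2_norm T E1 * L2_norm T W"
proof -
  have "L2_inner T E2 (\<lambda>t. exp (- t / T) * W t) \<le> L2_norm T E2 * L2_norm T W"
    using exp_weight_Cauchy_Schwarz[OF primitiveD(1)[OF assms(2)] assms(4,5)] by linarith
  moreover have "\<mu> * L2_inner T E (\<lambda>t. exp (- t / T) * W t) \<le> \<mu> * (T * L2_norm T E1 * L2_norm T W)"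
  proof (rule mult_left_mono[OF _ assms(6)])
    have "L2_inner T E (\<lambda>t. exp (- t / T) * W t) \<le> L2_norm T E * L2_norm T W"
      using exp_weight_Cauchy_Schwarz[OF primitive_L2[OF assms(1)] assms(4,5)] by linarith
    also have "\<dots> \<le> T * L2_norm T E1 * L2_norm T W"
      by (intro mult_right_mono Poincare[OF assms(1,3,5)] L2_norm_nonneg)
    finally show "L2_inner T E (\<lambda>t. exp (- t / T) * W t) \<le> T * L2_norm T E1 * L2_norm T W" .
  qed
  ultimately show ?thesis
    unfolding weighted_form_def using abs_ge_self[of "E1 0 * W 0"] by (simp add: mult.assoc)
qed

text \<open>If F is of order h and its derivative of order 1, then F(0) is of order h^(1/2). The
  summand |F|^2/T is of order h^2, and one h of it is absorbed by the bound c.\<close>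

lemma trace_bound_scaled:
  assumes "primitive T F f" "0 < T" "L2_norm T F \<le> A * h" "L2_norm T f \<le> B" "0 \<le> A" "0 < h" "h \<le> c"
  shows "(F 0)\<^sup>2 \<le> (c / T * A\<^sup>2 + 2 * A * B) * h"
proof -
  have "(F 0)\<^sup>2 \<le> (L2_norm T F)\<^sup>2 / T + 2 * (L2_norm T F * L2_norm T f)"
    by (rule trace_bound[OF assms(1,2)])
  also have "\<dots> \<le> (A * h)\<^sup>2 / T + 2 * (A * h * B)"
    using assms by (intro add_mono divide_right_mono power_mono mult_left_mono mult_mono) (auto simp: L2_norm_nonneg)
  also have "\<dots> = (h / T * A\<^sup>2 + 2 * A * B) * h"
    by (simp add: power2_eq_square algebra_simps)
  also have "\<dots> \<le> (c / T * A\<^sup>2 + 2 * A * B) * h"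
    using assms by (intro mult_right_mono add_right_mono divide_right_mono) auto
  finally show ?thesis .
qed

text \<open>One summand for each term of \<open>weighted_form_bound\<close>: c relates the
  approximation error of the dual solution to the norm of E, and r is an upper bound for h.\<close>

definition duality_const :: "real \<Rightarrow> real \<Rightarrow> real \<Rightarrow> real \<Rightarrow> real \<Rightarrow> real \<Rightarrow> real" where
  "duality_const T \<mu> K1 K2 c r =
     K2 * c + sqrt ((r / T * K1\<^sup>2 + 2 * K1 * K2) * (r / T * c\<^sup>2 + 2 * c * c) ) + \<mu> * T * K1 * c * r"

text \<open>Every term on the right is linear in the norm of E through the dual bound, so one factor
  can be divided out. Hypothesis \<open>approx\<close> packs approximation and Galerkin
  orthogonality together and keeps the discrete space out of the argument.\<close>

lemma duality_estimate:
  assumes E: "primitive T E E1" "primitive T E1 E2" "E 0 = 0" and T: "0 < T" and \<mu>: "0 < \<mu>"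
    and h: "0 < h" "h \<le> r"
    and E1: "L2_norm T E1 \<le> K1 * h ^ (n + 1)" and E2: "L2_norm T E2 \<le> K2 * h ^ n"
    and K: "0 \<le> K1" "0 \<le> K2" "0 \<le> Ca"
    and approx: "\<And>Z Z1 Z2 Z3. primitive T Z Z1 \<Longrightarrow> primitive T Z1 Z2 \<Longrightarrow> primitive T Z2 Z3 \<Longrightarrow> Z 0 = 0 \<Longrightarrow>
      \<exists>D1 D2. primitive T D1 D2 \<and> weighted_form T \<mu> E E1 E2 D1 = 0 \<and>
        L2_norm T (\<lambda>t. Z1 t - D1 t) \<le> Ca * h\<^sup>2 * L2_norm T Z3 \<and>
        L2_norm T (\<lambda>t. Z2 t - D2 t) \<le> Ca * h * L2_norm T Z3"
  shows "L2_norm T E \<le> duality_const T \<mu> K1 K2 (Ca * dual_bound T (sqrt \<mu>)) r * h ^ (n + 2)"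
proof -
  let ?x = "L2_norm T E"
  define c where "c = Ca * dual_bound T (sqrt \<mu>)"
  have c: "0 \<le> c"
    using K T \<mu> by (simp add: c_def dual_bound_def)
  obtain Z Z1 Z2 Z3 where Z: "primitive T Z Z1" "primitive T Z1 Z2" "primitive T Z2 Z3" "Z 0 = 0"
    "weighted_form T \<mu> E E1 E2 Z1 = ?x\<^sup>2" "L2_norm T Z3 \<le> dual_bound T (sqrt \<mu>) * ?x"
    using dual_solution[OF E T \<mu>] by blast
  obtain D1 D2 where D: "primitive T D1 D2" "weighted_form T \<mu> E E1 E2 D1 = 0"
    "L2_norm T (\<lambda>t. Z1 t - D1 t) \<le> Ca * h\<^sup>2 * L2_norm T Z3" "L2_norm T (\<lambda>t. Z2 t - D2 t) \<le> Ca * h * L2_norm T Z3"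
    using approx[OF Z(1-4)] by blast
  define W W' where "W t = Z1 t - D1 t" and "W' t = Z2 t - D2 t" for t
  have W: "primitive T W W'"
    using primitive_diff[OF Z(2) D(1)] by (simp add: W_def[abs_def] W'_def[abs_def])
  have x: "0 \<le> ?x"
    by (rule L2_norm_nonneg)
  have W1: "L2_norm T W \<le> (c * h * ?x) * h"
  proof -
    have "L2_norm T W \<le> Ca * h\<^sup>2 * L2_norm T Z3"
      using D(3) by (simp add: W_def[abs_def])
    also have "\<dots> \<le> Ca * h\<^sup>2 * (dual_bound T (sqrt \<mu>) * ?x)"
      using Z(6) K by (intro mult_left_mono) auto
    finally show ?thesis
      by (simp add: c_def power2_eq_square mult_ac)
  qed
  have W2: "L2_norm T W' \<le> c * h * ?x"
  proof -
    have "L2_norm T W' \<le> Ca * h * L2_norm T Z3"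
      using D(4) by (simp add: W'_def[abs_def])
    also have "\<dots> \<le> Ca * h * (dual_bound T (sqrt \<mu>) * ?x)"
      using Z(6) K h by (intro mult_left_mono) auto
    finally show ?thesis
      by (simp add: c_def mult_ac)
  qed
  have "weighted_form T \<mu> E E1 E2 W = ?x\<^sup>2"
    unfolding W_def[abs_def]
    using weighted_form_diff_right[OF primitive_L2[OF E(1)] primitiveD(1)[OF E(2)] primitive_L2[OF Z(2)] primitive_L2[OF D(1)] T]
      Z(5) D(2) by simp
  then have "?x\<^sup>2 \<le> L2_norm T E2 * L2_norm T W + \<bar>E1 0 * W 0\<bar> + \<mu> * T * L2_norm T E1 * L2_norm T W"
    using weighted_form_bound[OF E primitive_L2[OF W] T, of \<mu>] \<mu> by simp
  also have "\<dots> \<le> K2 * h ^ n * (c * h * ?x * h) +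
      sqrt ((r / T * K1\<^sup>2 + 2 * K1 * K2) * (r / T * c\<^sup>2 + 2 * c * c)) * (h ^ (n + 2) * ?x) +
      \<mu> * T * (K1 * h ^ (n + 1)) * (c * h * ?x * r)"
  proof (intro add_mono mult_mono mult_left_mono)
    show "L2_norm T W \<le> c * h * ?x * h"
      by (rule W1)
    \<comment> \<open>The third term would carry h^(n + 3); its spare power of h is replaced by
      r.\<close>
    also have "\<dots> \<le> c * h * ?x * r"
      using h c x by (intro mult_left_mono) auto
    finally show "L2_norm T W \<le> c * h * ?x * r" .
    \<comment> \<open>E1(0)^2 has order h^(2n + 1) and W(0)^2 has order h^3, so the root of the
      product has the required order h^(n + 2).\<close>
    have "(E1 0)\<^sup>2 \<le> (r / T * (K1 * h ^ n)\<^sup>2 + 2 * (K1 * h ^ n) * (K2 * h ^ n)) * h"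
      by (rule trace_bound_scaled[OF E(2) T]) (use E1 E2 K h in \<open>auto simp: mult_ac\<close>)
    moreover have "(W 0)\<^sup>2 \<le> (r / T * (c * h * ?x)\<^sup>2 + 2 * (c * h * ?x) * (c * h * ?x)) * h"
      by (rule trace_bound_scaled[OF W T W1 W2]) (use c h x in auto)
    ultimately have "(E1 0)\<^sup>2 * (W 0)\<^sup>2 \<le> ((r / T * (K1 * h ^ n)\<^sup>2 + 2 * (K1 * h ^ n) * (K2 * h ^ n)) * h) *
        ((r / T * (c * h * ?x)\<^sup>2 + 2 * (c * h * ?x) * (c * h * ?x)) * h)"
      by (rule mult_mono) (use T h K in auto)
    also have "\<dots> = ((r / T * K1\<^sup>2 + 2 * K1 * K2) * (r / T * c\<^sup>2 + 2 * c * c)) * (h ^ (n + 2) * ?x)\<^sup>2"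
      by (simp add: power2_eq_square algebra_simps)
    finally have "sqrt ((E1 0 * W 0)\<^sup>2) \<le> sqrt (((r / T * K1\<^sup>2 + 2 * K1 * K2) * (r / T * c\<^sup>2 + 2 * c * c)) * (h ^ (n + 2) * ?x)\<^sup>2)"
      unfolding power_mult_distrib[of "E1 0"] by (rule real_sqrt_le_mono)
    then show "\<bar>E1 0 * W 0\<bar> \<le> sqrt ((r / T * K1\<^sup>2 + 2 * K1 * K2) * (r / T * c\<^sup>2 + 2 * c * c)) * (h ^ (n + 2) * ?x)"
      using h x by (simp only: real_sqrt_mult real_sqrt_abs) simp
  qed (use E1 E2 K T \<mu> h c x in \<open>auto simp: L2_norm_nonneg\<close>)
  also have "\<dots> = (duality_const T \<mu> K1 K2 c r * h ^ (n + 2)) * ?x"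
    by (simp add: duality_const_def algebra_simps)
  finally have *: "?x * ?x \<le> (duality_const T \<mu> K1 K2 c r * h ^ (n + 2)) * ?x"
    by (simp add: power2_eq_square)
  have nonneg: "0 \<le> duality_const T \<mu> K1 K2 c r * h ^ (n + 2)"
    using K c T \<mu> h by (simp add: duality_const_def)
  show ?thesis
  proof (cases "?x = 0")
    case True
    then show ?thesis
      using nonneg by (simp add: c_def)
  next
    case False
    then have "0 < ?x"
      using x by simp
    with * show ?thesis
      unfolding c_def by (simp only: mult_le_cancel_right_pos)
  qed
qed

section \<open>Discrete spaces and the convergence theorem\<close>

lemma finite_dim_subspace_diff:
  assumes "finite_dim_subspace T V" "v \<in> V" "w \<in> V"
  shows "(\<lambda>t. v t - w t) \<in> V"
proof -
  obtain B :: "(real \<Rightarrow> real) set" where V: "V = {v. \<exists>c :: (real \<Rightarrow> real) \<Rightarrow> real. v = (\<lambda>t. \<Sum>b\<in>B. c b * b t)}"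
    using assms(1) unfolding finite_dim_subspace_def by blast
  obtain c d where "v = (\<lambda>t. \<Sum>b\<in>B. c b * b t)" "w = (\<lambda>t. \<Sum>b\<in>B. d b * b t)"
    using assms(2,3) unfolding V by blast
  then have "(\<lambda>t. v t - w t) = (\<lambda>t. \<Sum>b\<in>B. (c b - d b) * b t)"
    by (simp add: left_diff_distrib sum_subtractf)
  then show ?thesis
    unfolding V by (intro CollectI exI[of _ "\<lambda>b. c b - d b"])
qed

text \<open>The second claim rests on the 1/T term of \<open>H20_norm\<close>: a nonzero W1 would
  force 1/T \<le> C/h.\<close>

lemma inverse_inequality_H20_rep:
  assumes "H20_norm T w \<le> C * inverse h * L2_norm T (wderiv T 1 w)" "H20_rep T w W W1 W2" "0 < T" "0 < h"
  shows "L2_norm T W2 \<le> C / h * L2_norm T W1" "C * T < h \<Longrightarrow> L2_norm T W1 = 0"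
proof -
  have *: "L2_norm T W2 + 1 / T * L2_norm T W1 \<le> C / h * L2_norm T W1"
    using assms(1) unfolding H20_norm_def H20_rep_norms[OF assms(2,3)] by (simp add: divide_inverse)
  then show "L2_norm T W2 \<le> C / h * L2_norm T W1"
    using assms(3) L2_norm_nonneg[of T W1] by (smt (verit) divide_nonneg_pos mult_nonneg_nonneg)
  assume "C * T < h"
  then have "C / h < 1 / T"
    using assms(3,4) by (simp add: field_simps)
  have "1 / T * L2_norm T W1 \<le> C / h * L2_norm T W1"
    using * L2_norm_nonneg[of T W2] by linarith
  then have "(1 / T - C / h) * L2_norm T W1 \<le> 0"
    by (simp add: left_diff_distrib)
  then show "L2_norm T W1 = 0"
    using \<open>C / h < 1 / T\<close> L2_norm_nonneg[of T W1] by (simp add: mult_le_0_iff)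
qed

theorem theorem3p14:
  fixes T :: real and p :: nat and H :: "real set" and S :: "real \<Rightarrow> (real \<Rightarrow> real) set"
  assumes "0 < T" and "2 \<le> p" and "H \<subseteq> {0<..}"
    and "\<And>h. h \<in> H \<Longrightarrow> finite_dim_subspace T (S h)"
    and "assumption_A T p H S" and "assumption_B T p H S"
  shows "\<exists>m. \<forall>\<mu>>0. \<forall>u \<in> H20 T \<inter> Hk T m. \<exists>C>0.
           \<forall>f\<in>L2_space T.
             (\<forall>w\<in>H20 T. a_form T \<mu> u w = L2_inner T f (wderiv T 1 w)) \<longrightarrow>
             (\<forall>h\<in>H. \<forall>uh\<in>S h.
                (\<forall>wh\<in>S h. a_form T \<mu> uh (L_op T wh) = L2_inner T f (wderiv T 1 (L_op T wh))) \<longrightarrow>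
                (\<forall>l\<in>{0, 1, 2}.
                   L2_norm T (\<lambda>t. wderiv T l u t - wderiv T l uh t) \<le> C * h ^ (p + 1 - l)))"
proof -
  note T = assms(1)
  obtain CI where CI: "0 < CI" and
    inv: "\<And>h w. h \<in> H \<Longrightarrow> w \<in> S h \<Longrightarrow> H20_norm T w \<le> CI * inverse h * L2_norm T (wderiv T 1 w)"
    using assms(5) unfolding assumption_A_def inverse_inequalities_def by blast
  obtain Ca where Ca: "0 < Ca" and
    app: "\<And>h s w. h \<in> H \<Longrightarrow> s \<le> p \<Longrightarrow> w \<in> H20 T \<inter> Hk T (s + 1) \<Longrightarrow>
      \<exists>v\<in>S h. \<forall>l\<in>{0, 1, 2}. l \<le> s \<longrightarrow>
           L2_norm T (\<lambda>t. wderiv T l w t - wderiv T l v t) \<le> Ca * h ^ (s + 1 - l) * L2_norm T (wderiv T (s + 1) w)"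
    using assms(5) unfolding assumption_A_def approximation_property_def by meson
  obtain Q k where Q: "\<forall>h\<in>H. is_projection T (S h) (Q h)"
    "\<forall>h\<in>H. \<forall>u\<in>H20 T. trace_at T (wderiv T 1 (Q h u)) T = trace_at T (wderiv T 1 u) T \<and>
      (\<forall>w\<in>S h. L2_inner T (wderiv T 1 (Q h u)) (\<lambda>t. exp (- t / T) * wderiv T 2 w t)
        = L2_inner T (wderiv T 1 u) (\<lambda>t. exp (- t / T) * wderiv T 2 w t))"
    "\<forall>u\<in>H20 T \<inter> Hk T k. \<exists>C>0. \<forall>h\<in>H.
      L2_norm T (\<lambda>t. wderiv T 1 u t - wderiv T 1 (Q h u) t) \<le> C * h ^ p"
    using assms(6) unfolding assumption_B_def by (elim exE conjE)
  have QS: "Q h u \<in> S h" if "h \<in> H" "u \<in> H20 T" for h u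
    using bspec[OF Q(1) that(1)] that(2) by (simp add: is_projection_def)
  have H20S: "w \<in> H20 T" if "h \<in> H" "w \<in> S h" for h w
    using assms(4)[OF that(1)] that(2) unfolding finite_dim_subspace_def by blast
  \<comment> \<open>Naming p - 1 avoids truncated subtraction in the order of the second
    derivative.\<close>
  obtain n where n: "p = n + 1"
    using assms(2) by (metis Suc_eq_plus1 Suc_le_D numeral_2_eq_2)
  show ?thesis
  \<comment> \<open>k is the regularity required by Assumption B, and p + 1 the one for
    approximation with s = p.\<close>
  proof (intro exI[of _ "max k (p + 1)"] allI impI ballI)
    fix \<mu> :: real and u assume \<mu>: "0 < \<mu>" and u: "u \<in> H20 T \<inter> Hk T (max k (p + 1))"
    then have uH: "u \<in> H20 T" and uk: "u \<in> H20 T \<inter> Hk T k" and up: "u \<in> H20 T \<inter> Hk T (p + 1)"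
      using subsetD[OF sobolev_over_mono[OF max.cobounded1, of "L2_space T" T k "p + 1"]]
        subsetD[OF sobolev_over_mono[OF max.cobounded2, of "L2_space T" T k "p + 1"]] by simp_all
    obtain CQ where CQ: "0 < CQ" "\<And>h. h \<in> H \<Longrightarrow>
        L2_norm T (\<lambda>t. wderiv T 1 u t - wderiv T 1 (Q h u) t) \<le> CQ * h ^ p"
      using bspec[OF Q(3) uk] by blast
    obtain U U1 U2 where U: "H20_rep T u U U1 U2"
      using H20_rep_exists[OF uH T] .
    \<comment> \<open>M bounds the approximation of u, K1 adds projection and discrete error. K2
      inserts the approximant v: M for u'' - v'', the inverse inequality for (v - u_h)'', whose
      first-order counterpart is bounded through M + K1. K0 is the duality constant for h up to
      \<open>CI * T\<close>.\<close>
    define M where "M = Ca * L2_norm T (wderiv T (p + 1) u)"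
    define K1 where "K1 = CQ + 2 * T * exp 1 * (1 / T + \<mu> * T) * CQ"
    define K2 where "K2 = M + CI * (M + K1)"
    define K0 where "K0 = duality_const T \<mu> K1 K2 (Ca * dual_bound T (sqrt \<mu>)) (CI * T)"
    have M: "0 \<le> M"
      using Ca by (simp add: M_def L2_norm_nonneg)
    have K1: "0 < K1"
      using CQ T \<mu> by (simp add: K1_def add_pos_pos)
    have K2: "0 \<le> K2"
      using M K1 CI by (simp add: K2_def)
    have K0: "0 \<le> K0"
      using K1 K2 Ca CI T \<mu> by (simp add: K0_def duality_const_def dual_bound_def)
    have bounds: "L2_norm T (\<lambda>t. wderiv T 0 u t - wderiv T 0 uh t) \<le> (M + K0) * h ^ (p + 1)"
      "L2_norm T (\<lambda>t. wderiv T 1 u t - wderiv T 1 uh t) \<le> K1 * h ^ p"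
      "L2_norm T (\<lambda>t. wderiv T 2 u t - wderiv T 2 uh t) \<le> K2 * h ^ n"
      if f: "f \<in> L2_space T" and eq: "\<forall>w\<in>H20 T. a_form T \<mu> u w = L2_inner T f (wderiv T 1 w)"
        and h: "h \<in> H" and uh: "uh \<in> S h"
        and eqh: "\<forall>wh\<in>S h. a_form T \<mu> uh (L_op T wh) = L2_inner T f (wderiv T 1 (L_op T wh))"
      for f h uh
    proof -
      have h0: "0 < h"
        using h assms(3) by auto
      obtain Y Y1 Y2 where Y: "H20_rep T uh Y Y1 Y2"
        using H20_rep_exists[OF H20S[OF h uh] T] .
      define q where "q = Q h u"
      have qS: "q \<in> S h"
        unfolding q_def by (rule QS[OF h uH])
      obtain P P1 P2 where P: "H20_rep T q P P1 P2"
        using H20_rep_exists[OF H20S[OF h qS] T] .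
      \<comment> \<open>The projection error is controlled in the first derivative only; v supplies
        approximation of orders 0 and 2 as well.\<close>
      obtain v where vS: "v \<in> S h" and v': "\<forall>l\<in>{0, 1, 2}. l \<le> p \<longrightarrow>
          L2_norm T (\<lambda>t. wderiv T l u t - wderiv T l v t) \<le> Ca * h ^ (p + 1 - l) * L2_norm T (wderiv T (p + 1) u)"
        using app[OF h order_refl up] by blast
      have v: "L2_norm T (\<lambda>t. wderiv T l u t - wderiv T l v t) \<le> M * h ^ (p + 1 - l)" if "l \<in> {0, 1, 2}" for l
      proof -
        have "l \<le> p"
          using that assms(2) by auto
        then show ?thesis
          using bspec[OF v' that] by (simp only: M_def mult_ac)
      qed
      obtain V V1 V2 where V: "H20_rep T v V V1 V2"
        using H20_rep_exists[OF H20S[OF h vS] T] .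
      note rU = H20_repD[OF U] and rY = H20_repD[OF Y] and rP = H20_repD[OF P] and rV = H20_repD[OF V]
      define E E1 E2 where "E t = U t - Y t" and "E1 t = U1 t - Y1 t" and "E2 t = U2 t - Y2 t" for t
      have "H20_rep T (\<lambda>t. u t - uh t) E E1 E2"
        unfolding E_def[abs_def] E1_def[abs_def] E2_def[abs_def] by (rule H20_rep_diff[OF U Y])
      note rE = H20_repD[OF this]
      define N N1 N2 where "N t = U t - P t" and "N1 t = U1 t - P1 t" and "N2 t = U2 t - P2 t" for t
      have "H20_rep T (\<lambda>t. u t - q t) N N1 N2"
        unfolding N_def[abs_def] N1_def[abs_def] N2_def[abs_def] by (rule H20_rep_diff[OF U P])
      note rN = H20_repD[OF this]
      define D D1 D2 where "D t = Y t - P t" and "D1 t = Y1 t - P1 t" and "D2 t = Y2 t - P2 t" for t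
      have D: "H20_rep T (\<lambda>t. uh t - q t) D D1 D2"
        unfolding D_def[abs_def] D1_def[abs_def] D2_def[abs_def] by (rule H20_rep_diff[OF Y P])
      note rD = H20_repD[OF D]
      have DS: "(\<lambda>t. uh t - q t) \<in> S h"
        by (rule finite_dim_subspace_diff[OF assms(4)[OF h] uh qS])
      have galerkin: "weighted_form T \<mu> E E1 E2 W1 = 0" if "w \<in> S h" "H20_rep T w W W1 W2" for w W W1 W2
      proof -
        have "a_form T \<mu> u (L_op T w) = a_form T \<mu> uh (L_op T w)"
          using eq eqh L_op_in_H20[OF H20S[OF h that(1)] T] that(1) by simp
        then show ?thesis
          unfolding a_form_L_op[OF U that(2) T] a_form_L_op[OF Y that(2) T] E_def[abs_def] E1_def[abs_def] E2_def[abs_def]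
          using weighted_form_diff_left[OF rU(5,7) rY(5,7) H20_repD(6)[OF that(2)] T] by simp
      qed

      have N1: "L2_norm T N1 \<le> CQ * h ^ p"
        using CQ(2)[OF h] H20_rep_diff_norms(2)[OF U P T] by (simp add: N1_def[abs_def] q_def)
      have D1: "L2_norm T D1 \<le> 2 * T * exp 1 * (1 / T + \<mu> * T) * L2_norm T N1"
      proof (rule discrete_error_bound[OF rN(1-3) _ rD(1-3) T \<mu>])
        show "N1 T = 0"
          using Q(2) h uH H20_rep_trace(2)[OF U T, of T] H20_rep_trace(2)[OF P T, of T] T
          by (simp add: N1_def q_def)
        have ae: "ae_eq T (\<lambda>t. exp (- t / T) * wderiv T 2 (\<lambda>t. uh t - q t) t) (\<lambda>t. exp (- t / T) * D2 t)"
          by (rule ae_eq_mult[OF ae_eq_refl H20_rep_wderiv(3)[OF D T]])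
        have "L2_inner T U1 (\<lambda>t. exp (- t / T) * D2 t) = L2_inner T P1 (\<lambda>t. exp (- t / T) * D2 t)"
          using bspec[OF conjunct2[OF bspec[OF bspec[OF Q(2) h] uH]] DS] unfolding q_def[symmetric]
            L2_inner_cong[OF wderiv_L2(2)[OF U T] exp_weight_L2[OF wderiv_L2(3)[OF D T] T] H20_rep_wderiv(2)[OF U T] ae]
            L2_inner_cong[OF wderiv_L2(2)[OF P T] exp_weight_L2[OF wderiv_L2(3)[OF D T] T] H20_rep_wderiv(2)[OF P T] ae]
          by simp
        then show "L2_inner T N1 (\<lambda>t. exp (- t / T) * D2 t) = 0"
          unfolding N1_def[abs_def] using L2_inner_diff_left[OF rU(6) rP(6) exp_weight_L2[OF rD(7) T]] by simp
        \<comment> \<open>D = N - E, and the form of E vanishes on discrete functions, here on D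
          itself.\<close>
        have "weighted_form T \<mu> (\<lambda>t. N t - E t) (\<lambda>t. N1 t - E1 t) (\<lambda>t. N2 t - E2 t) D1 = weighted_form T \<mu> N N1 N2 D1"
          using weighted_form_diff_left[OF rN(5,7) rE(5,7) rD(6) T] galerkin[OF DS D] by simp
        moreover have "(\<lambda>t. N t - E t) = D" "(\<lambda>t. N1 t - E1 t) = D1" "(\<lambda>t. N2 t - E2 t) = D2"
          by (simp_all add: fun_eq_iff N_def E_def D_def N1_def E1_def D1_def N2_def E2_def D2_def)
        ultimately show "weighted_form T \<mu> D D1 D2 D1 = weighted_form T \<mu> N N1 N2 D1"
          by simp
      qed

      have nE1: "L2_norm T E1 \<le> K1 * h ^ p"
      proof -
        have "L2_norm T E1 \<le> L2_norm T N1 + L2_norm T D1"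
          using L2_norm_triangle_diff[OF rU(6) rP(6) rY(6)] L2_norm_minus_commute[of T P1 Y1]
          by (simp add: E1_def[abs_def] N1_def[abs_def] D1_def[abs_def])
        also have "\<dots> \<le> CQ * h ^ p + 2 * T * exp 1 * (1 / T + \<mu> * T) * (CQ * h ^ p)"
          using T \<mu> by (intro add_mono N1 order_trans[OF D1] mult_left_mono) auto
        finally show ?thesis
          by (simp add: K1_def algebra_simps)
      qed
      \<comment> \<open>Inverse inequalities need a discrete function, so they are applied to v -
        u_h instead of the error.\<close>
      have diffV: "H20_rep T (\<lambda>t. v t - uh t) (\<lambda>t. V t - Y t) (\<lambda>t. V1 t - Y1 t) (\<lambda>t. V2 t - Y2 t)"
        by (rule H20_rep_diff[OF V Y])
      note vinv = inverse_inequality_H20_rep[OF inv[OF h finite_dim_subspace_diff[OF assms(4)[OF h] vS uh]] diffV T h0]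
      have nV: "L2_norm T (\<lambda>t. U t - V t) \<le> M * h ^ (p + 1)" "L2_norm T (\<lambda>t. U1 t - V1 t) \<le> M * h ^ p"
        "L2_norm T (\<lambda>t. U2 t - V2 t) \<le> M * h ^ n"
        using v[of 0] v[of 1] v[of 2] H20_rep_diff_norms[OF U V T] by (simp_all add: n)
      have nE2: "L2_norm T E2 \<le> K2 * h ^ n"
      proof -
        have "L2_norm T (\<lambda>t. V1 t - Y1 t) \<le> L2_norm T (\<lambda>t. U1 t - V1 t) + L2_norm T E1"
          using L2_norm_triangle_diff[OF rV(6) rU(6) rY(6)] L2_norm_minus_commute[of T V1 U1]
          by (simp add: E1_def[abs_def])
        also have "\<dots> \<le> (M + K1) * h ^ p"
          using nV(2) nE1 by (simp add: distrib_right)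
        finally have "CI / h * L2_norm T (\<lambda>t. V1 t - Y1 t) \<le> CI / h * ((M + K1) * h ^ p)"
          using CI h0 by (intro mult_left_mono) auto
        also have "\<dots> = CI * (M + K1) * h ^ n"
          using h0 by (simp add: n)
        finally have "L2_norm T (\<lambda>t. V2 t - Y2 t) \<le> CI * (M + K1) * h ^ n"
          using vinv(1) by linarith
        then show ?thesis
          using L2_norm_triangle_diff[OF rU(7) rV(7) rY(7)] nV(3)
          by (simp add: E2_def[abs_def] K2_def distrib_right)
      qed
      have nE: "L2_norm T E \<le> (M + K0) * h ^ (p + 1)"
      proof (cases "h \<le> CI * T")
        case True
        have "L2_norm T E \<le> K0 * h ^ (n + 2)"
          unfolding K0_def
        proof (rule duality_estimate[OF rE(1-3) T \<mu> h0 True])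
          show "L2_norm T E1 \<le> K1 * h ^ (n + 1)" "L2_norm T E2 \<le> K2 * h ^ n" "0 \<le> K1" "0 \<le> K2" "0 \<le> Ca"
            using nE1 nE2 K1 K2 Ca by (simp_all add: n)
          fix Z Z1 Z2 Z3 assume Z: "primitive T Z Z1" "primitive T Z1 Z2" "primitive T Z2 Z3" "Z 0 = 0"
          note hk = H20_Hk3[OF Z T]
          have Z3: "L2_norm T (wderiv T 3 Z) = L2_norm T Z3"
            by (rule L2_norm_cong[OF primitiveD(1)[OF Z(3)] ae_eq_sym[OF hk(3)], symmetric])
          \<comment> \<open>s = 2 is admissible because 2 \<le> p; it gives orders h^2 and h for the
            first and second derivatives.\<close>
          obtain w where wS: "w \<in> S h" and w: "\<forall>l\<in>{0, 1, 2}. l \<le> 2 \<longrightarrow>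
              L2_norm T (\<lambda>t. wderiv T l Z t - wderiv T l w t) \<le> Ca * h ^ (2 + 1 - l) * L2_norm T (wderiv T (2 + 1) Z)"
            using app[OF h assms(2), of Z] hk(2) by auto
          obtain W W1 W2 where W: "H20_rep T w W W1 W2"
            using H20_rep_exists[OF H20S[OF h wS] T] .
          have "L2_norm T (\<lambda>t. Z1 t - W1 t) \<le> Ca * h\<^sup>2 * L2_norm T Z3" "L2_norm T (\<lambda>t. Z2 t - W2 t) \<le> Ca * h * L2_norm T Z3"
            using w H20_rep_diff_norms(2,3)[OF hk(1) W T] Z3 by simp_all
          then show "\<exists>D1 D2. primitive T D1 D2 \<and> weighted_form T \<mu> E E1 E2 D1 = 0 \<and>
              L2_norm T (\<lambda>t. Z1 t - D1 t) \<le> Ca * h\<^sup>2 * L2_norm T Z3 \<and>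
              L2_norm T (\<lambda>t. Z2 t - D2 t) \<le> Ca * h * L2_norm T Z3"
            using H20_repD(2)[OF W] galerkin[OF wS W] by blast
        qed
        also have "\<dots> \<le> (M + K0) * h ^ (n + 2)"
          using M h0 by (intro mult_right_mono) auto
        finally show ?thesis
          by (simp add: n)
      next
        case False
        \<comment> \<open>v - u_h has zero derivative and vanishes at 0, so u_h agrees with v almost
          everywhere and E is the approximation error of u.\<close>
        then have "L2_norm T (\<lambda>t. V1 t - Y1 t) = 0"
          using vinv(2) by simp
        then have "L2_norm T (\<lambda>t. V t - Y t) \<le> 0"
          using Poincare[OF H20_repD(1)[OF diffV] H20_repD(3)[OF diffV] T] by simp
        then have "L2_norm T E \<le> M * h ^ (p + 1)"
          using L2_norm_triangle_diff[OF rU(5) rV(5) rY(5)] nV(1) by (simp add: E_def[abs_def])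
        also have "\<dots> \<le> (M + K0) * h ^ (p + 1)"
          using K0 h0 by (intro mult_right_mono) auto
        finally show ?thesis .
      qed
      show "L2_norm T (\<lambda>t. wderiv T 0 u t - wderiv T 0 uh t) \<le> (M + K0) * h ^ (p + 1)"
        "L2_norm T (\<lambda>t. wderiv T 1 u t - wderiv T 1 uh t) \<le> K1 * h ^ p"
        "L2_norm T (\<lambda>t. wderiv T 2 u t - wderiv T 2 uh t) \<le> K2 * h ^ n"
        using nE nE1 nE2 unfolding H20_rep_diff_norms[OF U Y T] E_def[abs_def] E1_def[abs_def] E2_def[abs_def] .
    qed
    show "\<exists>C>0. \<forall>f\<in>L2_space T.
        (\<forall>w\<in>H20 T. a_form T \<mu> u w = L2_inner T f (wderiv T 1 w)) \<longrightarrow>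
        (\<forall>h\<in>H. \<forall>uh\<in>S h.
           (\<forall>wh\<in>S h. a_form T \<mu> uh (L_op T wh) = L2_inner T f (wderiv T 1 (L_op T wh))) \<longrightarrow>
           (\<forall>l\<in>{0, 1, 2}. L2_norm T (\<lambda>t. wderiv T l u t - wderiv T l uh t) \<le> C * h ^ (p + 1 - l)))"
    \<comment> \<open>The sum dominates the constants of all three orders, and it is fixed before f,
      h and uh.\<close>
    proof (intro exI[of _ "M + K0 + K1 + K2"] conjI ballI impI)
      show "0 < M + K0 + K1 + K2"
        using M K0 K1 K2 by linarith
      fix f h uh and l :: nat
      assume a: "f \<in> L2_space T" "\<forall>w\<in>H20 T. a_form T \<mu> u w = L2_inner T f (wderiv T 1 w)" "h \<in> H" "uh \<in> S h"
        "\<forall>wh\<in>S h. a_form T \<mu> uh (L_op T wh) = L2_inner T f (wderiv T 1 (L_op T wh))" and l: "l \<in> {0, 1, 2}"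
      have "\<exists>K. K \<le> M + K0 + K1 + K2 \<and> L2_norm T (\<lambda>t. wderiv T l u t - wderiv T l uh t) \<le> K * h ^ (p + 1 - l)"
      proof -
        consider "l = 0" | "l = 1" | "l = 2"
          using l by blast
        then show ?thesis
        proof cases
          case 1
          then show ?thesis
            using bounds(1)[OF a] K1 K2 by (intro exI[of _ "M + K0"]) simp
        next
          case 2
          then show ?thesis
            using bounds(2)[OF a] M K0 K2 by (intro exI[of _ K1]) simp
        next
          case 3
          then show ?thesis
            using bounds(3)[OF a] M K0 K1 by (intro exI[of _ K2]) (simp add: n)
        qed
      qed
      moreover have "0 \<le> h ^ (p + 1 - l)"
        using a(3) assms(3) by (intro zero_le_power) auto
      ultimately show "L2_norm T (\<lambda>t. wderiv T l u t - wderiv T l uh t) \<le> (M + K0 + K1 + K2) * h ^ (p + 1 - l)"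
        by (meson mult_right_mono order_trans)
    qed
  qed
qed

end
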